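(* Let $\alpha^+,\lambda^+,\alpha^-,\lambda^-\in(0,\infty)$ and $\beta^+,\beta^-\in(0,1)$, and let $g$ be the density of the tempered stable distribution $\eta=\mathrm{TS}(\alpha^+,\beta^+,\lambda^+;\alpha^-,\beta^-,\lambda^-)$. Then $g$ is of class $C^\infty(\mathbb{R})$ and there exists a point $x_0\in\mathbb{R}$ such that $$g'(x)>0\ \text{ for }x\in(-\infty,x_0),\qquad g'(x_0)=0,\qquad g'(x)<0\ \text{ for }x\in(x_0,\infty).$$ Moreover, $x_0\in(x_0^-,x_0^+)$, where $x_0^+$ denotes the mode of $\eta^+$ and $x_0^-$ denotes the mode of $\eta^-$; here $\eta^+=\mathrm{TS}(\alpha^+,\beta^+,\lambda^+)$ and $\eta^-$ is the dual of $\mathrm{TS}(\alpha^-,\beta^-,\lambda^-)$, so that $\eta=\eta^+*\eta^-$.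
   Context: For $\alpha,\lambda\in(0,\infty)$ and $\beta\in[0,1)$, the one-sided tempered stable distribution $\mathrm{TS}(\alpha,\beta,\lambda)$ is the infinitely divisible distribution on $\mathbb{R}$ with characteristic function $\varphi(z)=\exp\big(\int_{\mathbb{R}}(e^{izx}-1)F(dx)\big)$, $z\in\mathbb{R}$, where $F(dx)=\frac{\alpha}{x^{1+\beta}}e^{-\lambda x}\mathbf{1}_{(0,\infty)}(x)\,dx$. The dual of a distribution $\nu$ is $\widetilde\nu(B)=\nu(-B)$ for Borel sets $B$. The tempered stable distribution $\mathrm{TS}(\alpha^+,\beta^+,\lambda^+;\alpha^-,\beta^-,\lambda^-)$ is $\eta^+*\eta^-$ with $\eta^+=\mathrm{TS}(\alpha^+,\beta^+,\lambda^+)$ and $\eta^-$ the dual of $\mathrm{TS}(\alpha^-,\beta^-,\lambda^-)$. It is selfdecomposable, hence absolutely continuous; $g$ denotes its density. Mode: for $\beta\in(0,1)$ the density of $\mathrm{TS}(\alpha,\beta,\lambda)$ is $C^\infty$ on $\mathbb{R}$, vanishes on $(-\infty,0]$, and there is a unique point $m\in(0,\infty)$ such that its derivative is positive on $(0,m)$, zero at $m$ and negative on $(m,\infty)$; $m$ is called the mode of $\mathrm{TS}(\alpha,\beta,\lambda)$. The mode of the dual of $\mathrm{TS}(\alpha,\beta,\lambda)$ is $-m$ (the unique maximizer of its density). *)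

theory Defs
  imports "HOL-Probability.Probability"
begin

definition ts_levy_measure :: "real \<Rightarrow> real \<Rightarrow> real \<Rightarrow> real measure" where
  "ts_levy_measure \<alpha> \<beta> l =
     density lborel
       (\<lambda>x. ennreal (\<alpha> / x powr (1 + \<beta>) * exp (- l * x) * indicator {0<..} x))"

text \<open>The measure TS(alpha, beta, lambda). A probability measure on the Borel sets of the real line
  is determined by its characteristic function, so the description is unique (and existence holds
  for alpha, lambda > 0 and beta in [0,1)); infinite divisibility is a consequence of
  the form of the exponent, so it is not repeated in the description.\<close>

definition TS_one :: "real \<Rightarrow> real \<Rightarrow> real \<Rightarrow> real measure" where
  "TS_one \<alpha> \<beta> l =
     (THE M. real_distribution M \<and>
        (\<forall>z. char M z = exp (CLINT x|ts_levy_measure \<alpha> \<beta> l. iexp (z * x) - 1)))"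

definition dual :: "real measure \<Rightarrow> real measure" where
  "dual M = distr M borel uminus"

definition TS :: "real \<Rightarrow> real \<Rightarrow> real \<Rightarrow> real \<Rightarrow> real \<Rightarrow> real \<Rightarrow> real measure" where
  "TS \<alpha>p \<beta>p lp \<alpha>m \<beta>m lm = convolution (TS_one \<alpha>p \<beta>p lp) (dual (TS_one \<alpha>m \<beta>m lm))"

text \<open>A Lebesgue density is determined only almost everywhere, so this is a relation. Two continuous
  densities of the same measure agree everywhere; hence at most one density is smooth.
  Nonnegativity has to be required, since ennreal maps negative reals to 0.\<close>

definition is_density_of :: "(real \<Rightarrow> real) \<Rightarrow> real measure \<Rightarrow> bool" where
  "is_density_of g M \<longleftrightarrow>
     g \<in> borel_measurable borel \<and> (\<forall>x. 0 \<le> g x) \<and> M = density lborel (\<lambda>x. ennreal (g x))"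

definition smooth :: "(real \<Rightarrow> real) \<Rightarrow> bool" where
  "smooth g \<longleftrightarrow> (\<forall>n x. (deriv ^^ n) g differentiable (at x))"

text \<open>The mode of a one-sided distribution TS(alpha, beta, lambda) on the positive half-line;
  the mode of the dual distribution is the negative of this point.\<close>

definition mode :: "real measure \<Rightarrow> real" where
  "mode M =
     (THE m. 0 < m \<and>
        (\<exists>g. is_density_of g M \<and> smooth g \<and>
             (\<forall>x\<in>{0<..<m}. deriv g x > 0) \<and>
             deriv g m = 0 \<and>
             (\<forall>x\<in>{m<..}. deriv g x < 0)))"

end

theory Submission
  imports Defs
begin

text \<open>Write \<open>k(x) = \<alpha> x powr - \<beta> exp (- \<lambda> x)\<close> for \<open>x > 0\<close>. Since \<open>\<phi>' = \<i> \<phi> k^\<close> with \<open>k^\<close> the Fourier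
  transform of \<open>k\<close>, the Fourier inverse \<open>f\<close> of the characteristic function satisfies
  \<open>x f(x) = \<integral> f(x - y) k(y) dy\<close>. For a bounded smooth solution this equation forces \<open>f = 0\<close> on the
  negative half-line and a constant sign on the positive one, so that \<open>f\<close> is a probability density,
  and, because \<open>k\<close> decreases, \<open>f'\<close> changes sign exactly once.

  Multiplying \<open>f\<close> by \<open>exp (- c x)\<close> only changes \<open>\<lambda>\<close>, hence \<open>f' - c f\<close> also changes sign
  exactly once for every \<open>c \<ge> 0\<close>; this encodes strict log-concavity to the left of the mode. For
  \<open>g(x) = \<integral> p(u) q(u - x) du\<close> one has \<open>g''(x) = - \<integral> p'(u) q'(u - x) du\<close>. At a critical point \<open>x\<close>
  of \<open>g\<close> one may subtract from \<open>q'\<close> a multiple \<open>c q\<close> chosen such that both factors change sign at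
  the mode of \<open>p\<close> (or the same with \<open>p\<close> and \<open>q\<close> exchanged), so \<open>g''(x) < 0\<close>: all critical points
  are strict maxima.\<close>

text \<open>\<open>TS_one\<close> is a definite description, so a law with the prescribed
  characteristic function has to be produced first. The Fourier inverse is not known in advance to
  be nonnegative or even integrable: its sign is read off from the integral equation, its mass only
  afterwards. The threshold in that equation is k = 1: once f vanishes on the left, f is the
  integral of f', and differentiating gives x f'(x) = integral of f'(x - y) (k(y) - 1) over (0, x).
  Since beta > 0, k exceeds 1 near 0.

  Convolutions of unimodal densities need not be unimodal, and log-concavity, which would exclude
  this, is available only left of the mode. At a critical point x of g this is enough: g'(x) = 0
  says that the integral of p'(u) q(u - x) vanishes, so subtracting c q from q' costs nothing. If
  the mode a of p does not exceed the shifted mode b + x of q, then q'/q is nonnegative at a - x and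
  is an admissible c; otherwise p and q change roles. Hence only tilts with c >= 0, which increase
  lambda, are ever needed.\<close>

section \<open>Positivity and differentiation of Lebesgue integrals\<close>

lemma lborel_integral_pos:
  fixes h :: "real \<Rightarrow> real"
  assumes int: "integrable lborel h" and nn: "\<And>y. 0 \<le> h y"
    and pos: "\<And>y. a < y \<Longrightarrow> y < b \<Longrightarrow> 0 < h y" and ab: "a < b"
  shows "0 < integral\<^sup>L lborel h"
proof -
  have "integral\<^sup>L lborel h \<noteq> 0"
  proof
    assume "integral\<^sup>L lborel h = 0"
    then have "AE y in lborel. h y = 0"
      using integral_nonneg_eq_0_iff_AE[OF int] nn by simp
    then have "AE y in lborel. y \<notin> {a<..<b}"
      by (rule AE_mp) (use pos in \<open>force intro!: AE_I2\<close>)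
    then have "{a<..<b} \<in> null_sets lborel"
      by (subst AE_iff_null_sets) auto
    then show False using ab by (simp add: null_sets_def)
  qed
  moreover have "0 \<le> integral\<^sup>L lborel h" using nn by simp
  ultimately show ?thesis by linarith
qed

lemma has_vector_derivative_iff_quotient:
  fixes f :: "real \<Rightarrow> 'a::real_normed_vector"
  shows "(f has_vector_derivative D) (at x) \<longleftrightarrow>
    ((\<lambda>s. (1 / (s - x)) *\<^sub>R (f s - f x)) \<longlongrightarrow> D) (at x)"
proof -
  have "(f has_vector_derivative D) (at x) \<longleftrightarrow>
      ((\<lambda>y. (1 / norm (y - x)) *\<^sub>R (f y - (f x + (y - x) *\<^sub>R D))) \<longlongrightarrow> 0) (at x)"
    unfolding has_vector_derivative_def has_derivative_at2
    by (simp add: bounded_linear_scaleR_left)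
  also have "\<dots> \<longleftrightarrow> ((\<lambda>y. norm ((1 / norm (y - x)) *\<^sub>R (f y - (f x + (y - x) *\<^sub>R D)))) \<longlongrightarrow> 0) (at x)"
    by (simp only: tendsto_norm_zero_iff)
  also have "\<dots> \<longleftrightarrow> ((\<lambda>y. norm ((1 / (y - x)) *\<^sub>R (f y - f x) - D)) \<longlongrightarrow> 0) (at x)"
  proof (rule filterlim_cong[OF refl refl])
    show "\<forall>\<^sub>F y in at x. norm ((1 / norm (y - x)) *\<^sub>R (f y - (f x + (y - x) *\<^sub>R D)))
        = norm ((1 / (y - x)) *\<^sub>R (f y - f x) - D)"
      unfolding eventually_at_filter
    proof (intro always_eventually allI impI)
      fix y assume "y \<noteq> x"
      then have "(1 / (y - x)) *\<^sub>R (f y - f x) - D = (1 / (y - x)) *\<^sub>R (f y - (f x + (y - x) *\<^sub>R D))"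
        by (simp add: scaleR_diff_right scaleR_add_right)
      then show "norm ((1 / norm (y - x)) *\<^sub>R (f y - (f x + (y - x) *\<^sub>R D)))
        = norm ((1 / (y - x)) *\<^sub>R (f y - f x) - D)"
        by simp
    qed
  qed
  also have "\<dots> \<longleftrightarrow> ((\<lambda>s. (1 / (s - x)) *\<^sub>R (f s - f x)) \<longlongrightarrow> D) (at x)"
    by (simp only: tendsto_norm_zero_iff LIM_zero_iff)
  finally show ?thesis .
qed

text \<open>Dominated convergence along arbitrary sequences of difference quotients; the mean value
  inequality turns the bound on \<open>G'\<close> into a bound on the quotients.\<close>

lemma has_vector_derivative_lebesgue_integral:
  fixes G :: "real \<Rightarrow> 'b \<Rightarrow> 'c::{banach, second_countable_topology}"
  assumes int: "\<And>x. integrable M (G x)"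
    and der: "\<And>x y. ((\<lambda>x. G x y) has_vector_derivative G' x y) (at x)"
    and bnd: "\<And>x y. norm (G' x y) \<le> w y"
    and w: "integrable M w"
    and meas: "\<And>x. G' x \<in> borel_measurable M"
  shows "((\<lambda>x. integral\<^sup>L M (G x)) has_vector_derivative integral\<^sup>L M (G' x)) (at x)"
proof -
  have intG': "integrable M (G' x)" for x
    using meas bnd by (intro Bochner_Integration.integrable_bound[OF w]) (auto intro!: AE_I2 order_trans[OF bnd])
  have quot: "((\<lambda>s. (1 / (s - x)) *\<^sub>R (integral\<^sup>L M (G s) - integral\<^sup>L M (G x))) \<longlongrightarrow> integral\<^sup>L M (G' x)) (at x)"
    unfolding tendsto_at_iff_sequentially
  proof (intro allI impI)
    fix X :: "nat \<Rightarrow> real"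
    assume X: "\<forall>i. X i \<in> UNIV - {x}" "X \<longlonglongrightarrow> x"
    have eq: "(1 / (X i - x)) *\<^sub>R (integral\<^sup>L M (G (X i)) - integral\<^sup>L M (G x))
        = integral\<^sup>L M (\<lambda>y. (1 / (X i - x)) *\<^sub>R (G (X i) y - G x y))" for i
      using int by simp
    have "(\<lambda>i. integral\<^sup>L M (\<lambda>y. (1 / (X i - x)) *\<^sub>R (G (X i) y - G x y))) \<longlonglongrightarrow> integral\<^sup>L M (G' x)"
    proof (rule integral_dominated_convergence[where w=w])
      show "AE y in M. (\<lambda>i. (1 / (X i - x)) *\<^sub>R (G (X i) y - G x y)) \<longlonglongrightarrow> G' x y"
      proof (intro AE_I2)
        fix y
        have "((\<lambda>s. (1/(s-x)) *\<^sub>R (G s y - G x y)) \<longlongrightarrow> G' x y) (at x)"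
          using der[of y x] by (simp only: has_vector_derivative_iff_quotient)
        then show "(\<lambda>i. (1 / (X i - x)) *\<^sub>R (G (X i) y - G x y)) \<longlonglongrightarrow> G' x y"
          using X unfolding tendsto_at_iff_sequentially by (auto simp: o_def)
      qed
      show "AE y in M. norm ((1 / (X i - x)) *\<^sub>R (G (X i) y - G x y)) \<le> w y" for i
      proof (intro AE_I2)
        fix y
        have "norm (G (X i) y - G x y) \<le> w y * norm (X i - x)"
          by (rule differentiable_bound[where S=UNIV and f'="\<lambda>t h. h *\<^sub>R G' t y"])
            (use der in \<open>auto simp: has_vector_derivative_def mult.commute
                intro!: onorm_bound mult_left_mono bnd order_trans[OF norm_ge_zero bnd] has_derivative_at_withinI\<close>)
        moreover have "X i \<noteq> x" using X by auto
        ultimately show "norm ((1 / (X i - x)) *\<^sub>R (G (X i) y - G x y)) \<le> w y"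
          by (simp add: divide_simps)
      qed
    qed (use int w intG' in \<open>auto intro!: borel_measurable_integrable\<close>)
    then show "((\<lambda>s. (1 / (s - x)) *\<^sub>R (integral\<^sup>L M (G s) - integral\<^sup>L M (G x))) \<circ> X) \<longlonglongrightarrow> integral\<^sup>L M (G' x)"
      by (simp add: o_def eq)
  qed
  show ?thesis
    using quot by (simp only: has_vector_derivative_iff_quotient)
qed

lemma continuous_on_lebesgue_integral_shift:
  fixes P w :: "real \<Rightarrow> real"
  assumes "continuous_on UNIV P" "\<And>x. \<bar>P x\<bar> \<le> B" "integrable lborel w"
  shows "integrable lborel (\<lambda>y. P (x - y) * w y)"
proof (rule Bochner_Integration.integrable_bound[where f="\<lambda>y. B * w y"])
  have [measurable]: "P \<in> borel_measurable borel"
    using assms(1) by (rule borel_measurable_continuous_onI)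
  have [measurable]: "w \<in> borel_measurable borel" using assms(3) by (auto dest: borel_measurable_integrable)
  show "(\<lambda>y. P (x - y) * w y) \<in> borel_measurable lborel" by measurable
  have "0 \<le> B" using assms(2)[of 0] by linarith
  then show "AE y in lborel. norm (P (x - y) * w y) \<le> norm (B * w y)"
    using assms(2) by (intro AE_I2) (simp add: abs_mult mult_right_mono)
qed (use assms in auto)

lemma has_real_derivative_convolution:
  fixes P P' w :: "real \<Rightarrow> real"
  assumes "\<And>x. (P has_real_derivative P' x) (at x)" "continuous_on UNIV P'"
    and "\<And>x. \<bar>P x\<bar> \<le> B" "\<And>x. \<bar>P' x\<bar> \<le> B'" and w: "integrable lborel w"
  shows "((\<lambda>x. LINT y|lborel. P (x - y) * w y) has_real_derivative (LINT y|lborel. P' (x - y) * w y)) (at x)"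
  unfolding has_real_derivative_iff_has_vector_derivative
proof (rule has_vector_derivative_lebesgue_integral[where w="\<lambda>y. B' * \<bar>w y\<bar>"])
  have cP: "continuous_on UNIV P"
    using assms(1) by (meson DERIV_isCont continuous_at_imp_continuous_on)
  show "integrable lborel (\<lambda>y. P (x - y) * w y)" for x
    by (rule continuous_on_lebesgue_integral_shift[OF cP assms(3) w])
  show "((\<lambda>x. P (x - y) * w y) has_vector_derivative P' (x - y) * w y) (at x)" for x y
    unfolding has_real_derivative_iff_has_vector_derivative[symmetric]
    by (auto intro!: derivative_eq_intros DERIV_cmult_right DERIV_chain'[where f="\<lambda>x. x - y" and g=P, OF _ assms(1), of 1, simplified])
  show "(\<lambda>y. P' (x - y) * w y) \<in> borel_measurable lborel" for x
    using continuous_on_lebesgue_integral_shift[OF assms(2,4) w] by (rule borel_measurable_integrable)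
qed (use assms in \<open>auto simp: abs_mult intro!: mult_right_mono\<close>)

section \<open>Volterra equations with a decreasing kernel\<close>

text \<open>Only these properties of the kernel enter the analysis of the equation, so one argument
  covers a tempered kernel and all its tilts.\<close>

locale decreasing_kernel =
  fixes k k' :: "real \<Rightarrow> real"
  assumes k_nonpos: "x \<le> 0 \<Longrightarrow> k x = 0"
    and k_pos: "0 < x \<Longrightarrow> 0 < k x"
    and k_deriv: "0 < x \<Longrightarrow> (k has_real_derivative k' x) (at x)"
    and k'_neg: "0 < x \<Longrightarrow> k' x < 0"
    and k_int: "integrable lborel k"
    and k_large: "\<exists>d>0. 1 < k d"
    and k_small: "((\<lambda>x. x * k x) \<longlongrightarrow> 0) (at_right 0)"
begin

lemma k_nonneg: "0 \<le> k x"
  using k_nonpos[of x] k_pos[of x] by (cases "x \<le> 0") auto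

lemma k_less:
  assumes "0 < x" "x < y"
  shows "k y < k x"
proof (rule DERIV_neg_imp_decreasing[OF assms(2)])
  show "\<exists>y. (k has_real_derivative y) (at t) \<and> y < 0" if "x \<le> t" for t
    using k_deriv[of t] k'_neg[of t] assms(1) that by (intro exI[of _ "k' t"]) auto
qed

lemma k_le: "0 < x \<Longrightarrow> x \<le> y \<Longrightarrow> k y \<le> k x"
  using k_less[of x y] by (cases "x = y") auto

lemma k_meas [measurable]: "k \<in> borel_measurable borel"
  using k_int by (auto dest: borel_measurable_integrable)

text \<open>Supplies the small constants of the contraction arguments: on a short window the kernel
  acts with arbitrarily small norm.\<close>

lemma mass_small:
  assumes "0 < e"
  shows "\<exists>d>0. (LINT y|lborel. indicator {..d} y * k y) < e"
proof -
  have "(\<lambda>n. LINT y|lborel. indicator {..inverse (real (Suc n))} y * k y) \<longlonglongrightarrow> integral\<^sup>L lborel (\<lambda>y::real. 0::real)"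
  proof (rule integral_dominated_convergence[where w=k])
    show "AE y in lborel. (\<lambda>n. indicator {..inverse (real (Suc n))} y * k y) \<longlonglongrightarrow> 0"
    proof (intro AE_I2)
      fix y
      show "(\<lambda>n. indicator {..inverse (real (Suc n))} y * k y) \<longlonglongrightarrow> 0"
      proof (cases "y \<le> 0")
        case False
        then have "\<forall>\<^sub>F n in sequentially. inverse (real (Suc n)) < y"
          using LIMSEQ_inverse_real_of_nat by (intro order_tendstoD) auto
        then show ?thesis
          by (intro tendsto_eventually) (auto elim!: eventually_mono)
      qed (simp add: k_nonpos)
    qed
    show "AE y in lborel. norm (indicator {..inverse (real (Suc n))} y * k y) \<le> k y" for n
      by (intro AE_I2) (auto simp: k_nonneg indicator_def)
  qed (use k_int in auto)
  then have "\<forall>\<^sub>F n in sequentially. (LINT y|lborel. indicator {..inverse (real (Suc n))} y * k y) < e"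
    using assms by (intro order_tendstoD(2)) auto
  from eventually_happens'[OF sequentially_bot this]
  obtain n where "(LINT y|lborel. indicator {..inverse (real (Suc n))} y * k y) < e" ..
  then show ?thesis by (intro exI[of _ "inverse (real (Suc n))"]) auto
qed

lemma integrable_continuous_mult:
  assumes "continuous_on UNIV P"
  shows "integrable lborel (\<lambda>y. P y * k y * indicator {0..x} y)"
proof -
  obtain C where C: "\<And>y. y \<in> {0..x} \<Longrightarrow> norm (P y) \<le> C"
    using compact_imp_bounded[OF compact_continuous_image[OF continuous_on_subset[OF assms] compact_Icc[of 0 x]]]
    unfolding bounded_iff by blast
  have [measurable]: "P \<in> borel_measurable borel"
    using assms by (rule borel_measurable_continuous_onI)
  show ?thesis
  proof (rule Bochner_Integration.integrable_bound[where f="\<lambda>y. C * k y"])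
    show "AE y in lborel. norm (P y * k y * indicator {0..x} y) \<le> norm (C * k y)"
      using C by (intro AE_I2) (force simp: abs_mult indicator_def intro!: mult_right_mono)
  qed (use k_int in auto)
qed

text \<open>Integration by parts against the singular kernel: the boundary term at 0 vanishes by
  \<open>k_small\<close>, and the remaining integral has a sign because \<open>k\<close> decreases.\<close>

lemma kernel_by_parts:
  fixes W W' :: "real \<Rightarrow> real"
  assumes W: "\<And>y. (W has_real_derivative W' y) (at y)" and cW': "continuous_on UNIV W'"
    and W0: "W 0 = 0" and x: "0 < x" and nn: "\<And>y. 0 < y \<Longrightarrow> y < x \<Longrightarrow> 0 \<le> W y"
  shows "W x * k x \<le> (LINT y|lborel. W' y * k y * indicator {0..x} y)"
proof -
  define J where "J t = integral {0..t} (\<lambda>y. W' y * k y)" for t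
  have abs: "set_integrable lborel {0..x} (\<lambda>y. W' y * k y)"
    using integrable_continuous_mult[OF cW', of x] unfolding set_integrable_def
    by (simp add: mult_ac)
  have int: "(\<lambda>y. W' y * k y) integrable_on {0..x}"
    using set_borel_integral_eq_integral(1)[OF abs] .
  have Jx: "J x = (LINT y|lborel. W' y * k y * indicator {0..x} y)"
    using set_borel_integral_eq_integral(2)[OF abs] unfolding J_def set_lebesgue_integral_def
    by (simp add: mult_ac)
  have contJ: "continuous_on {0..x} J"
    unfolding J_def by (rule indefinite_integral_continuous_1[OF int])
  \<comment> \<open>\<open>W t / t\<close> converges because \<open>W 0 = 0\<close>; so the decay of
    \<open>t * k t\<close> suffices although \<open>k\<close> may blow up at 0.\<close>
  have Wk0: "((\<lambda>t. W t * k t) \<longlongrightarrow> 0) (at_right 0)"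
  proof -
    have "((\<lambda>t. (W t - W 0) / (t - 0)) \<longlongrightarrow> W' 0) (at 0)"
      using W[of 0] by (simp add: has_field_derivative_iff)
    then have "((\<lambda>t. W t / t) \<longlongrightarrow> W' 0) (at_right 0)"
      by (simp add: W0 filterlim_at_split)
    from tendsto_mult[OF this k_small]
    have "((\<lambda>t. W t / t * (t * k t)) \<longlongrightarrow> 0) (at_right 0)" by simp
    then show ?thesis
      by (rule Lim_transform_eventually) (auto simp: eventually_at_filter)
  qed
  have cont: "continuous_on {0..x} (\<lambda>t. J t - W t * k t)"
  proof (rule continuous_on_diff[OF contJ])
    show "continuous_on {0..x} (\<lambda>t. W t * k t)"
      unfolding continuous_on_eq_continuous_within
    proof
      fix t assume t: "t \<in> {0..x}"
      show "continuous (at t within {0..x}) (\<lambda>t. W t * k t)"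
      proof (cases "t = 0")
        case True
        have "at 0 within {0..x} = at_right 0" using x by (simp add: at_within_Icc_at_right)
        then show ?thesis using Wk0 True W0 by (simp add: continuous_within)
      next
        case False
        then have "0 < t" using t by auto
          then have "isCont (\<lambda>t. W t * k t) t"
            by (intro continuous_mult DERIV_isCont[OF W] DERIV_isCont[OF k_deriv])
          then show ?thesis by (rule continuous_at_imp_continuous_at_within)
      qed
    qed
  qed
  have "J 0 - W 0 * k 0 \<le> J x - W x * k x"
  proof (rule DERIV_nonneg_imp_increasing_open[OF less_imp_le[OF x] _ cont])
    fix t assume t: "0 < t" "t < x"
    have ct: "continuous (at t within {0..x}) (\<lambda>y. W' y * k y)"
    proof (rule continuous_at_imp_continuous_at_within, rule continuous_mult)
      show "isCont W' t" using cW' by (simp add: continuous_on_eq_continuous_at)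
      show "isCont k t" using k_deriv[OF t(1)] by (rule DERIV_isCont)
    qed
    have "(J has_vector_derivative W' t * k t) (at t within {0..x})"
      unfolding J_def using integral_has_vector_derivative_continuous_at[OF int, of t "{}"] ct t by simp
    then have "(J has_real_derivative W' t * k t) (at t)"
      using t by (simp add: has_real_derivative_iff_has_vector_derivative at_within_Icc_at)
    then have "((\<lambda>t. J t - W t * k t) has_real_derivative (W' t * k t - (W' t * k t + W t * k' t))) (at t)"
      using W k_deriv[of t] t by (auto intro!: derivative_eq_intros)
    moreover have "W t * k' t \<le> 0"
      using nn[of t] k'_neg[of t] t by (simp add: mult_nonneg_nonpos)
    ultimately show "\<exists>y. ((\<lambda>t. J t - W t * k t) has_real_derivative y) (at t) \<and> 0 \<le> y"
      by (intro exI conjI) auto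
  qed
  then show ?thesis by (simp add: J_def W0 Jx[symmetric])
qed

end

section \<open>Support and sign of bounded solutions\<close>

text \<open>Neither sign nor support nor integrability of \<open>f\<close> is assumed, because none
  of them is known of a Fourier inverse.\<close>

locale volterra = decreasing_kernel +
  fixes f f1 :: "real \<Rightarrow> real" and B :: real
  assumes f_deriv: "(f has_real_derivative f1 x) (at x)"
    and f1_cont: "continuous_on UNIV f1"
    and f_bound: "\<bar>f x\<bar> \<le> B" and f1_bound: "\<bar>f1 x\<bar> \<le> B"
    and f_eq: "x * f x = (LINT y|lborel. f (x - y) * k y)"
begin

lemma f_isCont: "isCont f x"
  using f_deriv by (rule DERIV_isCont)

lemma f_cont: "continuous_on S f"
  using f_isCont by (simp add: continuous_at_imp_continuous_on)

lemma f_meas [measurable]: "f \<in> borel_measurable borel"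
  using f_cont by (rule borel_measurable_continuous_onI)

lemma f1_meas [measurable]: "f1 \<in> borel_measurable borel"
  using f1_cont by (rule borel_measurable_continuous_onI)

lemmas int_f = continuous_on_lebesgue_integral_shift[OF f_cont f_bound k_int]
lemmas int_f1 = continuous_on_lebesgue_integral_shift[OF f1_cont f1_bound k_int]

lemma f1_eq: "f x + x * f1 x = (LINT y|lborel. f1 (x - y) * k y)"
proof -
  have "((\<lambda>x. x * f x) has_real_derivative (LINT y|lborel. f1 (x - y) * k y)) (at x)"
    unfolding f_eq
    by (rule has_real_derivative_convolution[OF f_deriv f1_cont f_bound f1_bound k_int])
  moreover have "((\<lambda>x. x * f x) has_real_derivative (f x + x * f1 x)) (at x)"
    using f_deriv by (auto intro!: derivative_eq_intros)
  ultimately show ?thesis by (rule DERIV_unique[symmetric])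
qed

text \<open>For x in a left half-line the convolution only looks further left, so \<bar>x\<bar> *
  \<bar>f x\<bar> is at most S * K, with S the supremum of \<bar>f\<bar> on that half-line. Where
  \<bar>x\<bar> exceeds the kernel mass K this is a strict contraction.\<close>

lemma vanishes_left: "\<exists>R. \<forall>x\<le>R. f x = 0"
proof -
  define K where "K = (LINT y|lborel. k y)"
  have K0: "0 \<le> K" unfolding K_def using k_nonneg by simp
  \<comment> \<open>Exceeds K by K + 1, so that S \<le> S * K / R becomes S * (K + 1) \<le>
    0.\<close>
  define R where "R = 2 * K + 1"
  define S where "S = (SUP x\<in>{..-R}. \<bar>f x\<bar>)"
  have bdd: "bdd_above ((\<lambda>x. \<bar>f x\<bar>) ` {..-R})" using f_bound by (auto intro!: bdd_aboveI)
  have S: "\<bar>f x\<bar> \<le> S" if "x \<le> -R" for x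
    unfolding S_def using that by (intro cSUP_upper bdd) auto
  have "\<bar>f x\<bar> \<le> S * K / R" if x: "x \<le> -R" for x
  proof -
    have "R * \<bar>f x\<bar> \<le> \<bar>x\<bar> * \<bar>f x\<bar>" using x K0 R_def by (intro mult_right_mono) auto
    also have "\<dots> = \<bar>LINT y|lborel. f (x - y) * k y\<bar>" by (simp flip: f_eq abs_mult)
    also have "\<dots> \<le> (LINT y|lborel. S * k y)"
    proof (rule integral_abs_bound[THEN order_trans], rule integral_mono)
      show "\<bar>f (x - y) * k y\<bar> \<le> S * k y" for y
        using S[of "x - y"] x k_nonneg[of y] k_nonpos[of y]
        by (cases "y \<le> 0") (auto simp: abs_mult intro!: mult_right_mono)
    qed (use int_f k_int in auto)
    finally have "R * \<bar>f x\<bar> \<le> S * K" by (simp add: K_def)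
    then show ?thesis using K0 by (simp add: R_def field_simps)
  qed
  then have "S \<le> S * K / R" unfolding S_def by (intro cSUP_least) auto
  moreover have "0 \<le> S" using S[of "-R"] by linarith
  moreover from calculation have "S * (K + 1) \<le> 0" using K0 by (simp add: R_def field_simps)
  ultimately have "S = 0" using K0 by (simp add: mult_le_0_iff)
  then show ?thesis using S by (intro exI[of _ "-R"]) auto
qed

text \<open>On a short window beyond \<open>a\<close> the factor x has size at least \<bar>a\<bar> /
  2, while only values of f inside the window contribute to the convolution, with kernel mass below
  \<bar>a\<bar> / 2. At the maximum of \<bar>f\<bar> on the window this forces 0. Only at a = 0,
  where the factor x degenerates, does the argument stop.\<close>

lemma vanishes_extend:
  assumes a: "a \<noteq> 0" and z: "\<And>x. x \<le> a \<Longrightarrow> f x = 0"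
  shows "\<exists>d>0. \<forall>x\<le>a + d. f x = 0"
proof -
  obtain d0 where d0: "d0 > 0" "(LINT y|lborel. indicator {..d0} y * k y) < \<bar>a\<bar> / 2"
    using mass_small[of "\<bar>a\<bar> / 2"] a by auto
  define d where "d = min d0 (\<bar>a\<bar> / 2)"
  have d: "d > 0" "d \<le> d0" "d \<le> \<bar>a\<bar> / 2" using d0 a by (auto simp: d_def)
  obtain s where s: "s \<in> {a..a + d}" "\<And>x. x \<in> {a..a + d} \<Longrightarrow> \<bar>f x\<bar> \<le> \<bar>f s\<bar>"
    using continuous_attains_sup[of "{a..a+d}" "\<lambda>x. \<bar>f x\<bar>"] d f_cont by (force intro!: continuous_intros)
  have "\<bar>a\<bar> / 2 * \<bar>f s\<bar> \<le> \<bar>s\<bar> * \<bar>f s\<bar>" using s(1) d by (intro mult_right_mono) auto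
  also have "\<dots> = \<bar>LINT y|lborel. f (s - y) * k y\<bar>" by (simp flip: f_eq abs_mult)
  also have "\<dots> \<le> (LINT y|lborel. \<bar>f s\<bar> * (indicator {..d0} y * k y))"
  proof (rule integral_abs_bound[THEN order_trans], rule integral_mono)
    show "\<bar>f (s - y) * k y\<bar> \<le> \<bar>f s\<bar> * (indicator {..d0} y * k y)" for y
    proof (cases "y \<le> 0 \<or> s - y \<le> a")
      case True
      then show ?thesis using z k_nonpos k_nonneg by auto
    next
      case False
      then show ?thesis using s d k_nonneg[of y] by (auto simp: abs_mult intro!: mult_right_mono)
    qed
    have "integrable lborel (\<lambda>y. indicator {..d0} y * k y)"
      using integrable_mult_indicator[of "{..d0}" lborel k] k_int by simp
    then show "integrable lborel (\<lambda>y. \<bar>f s\<bar> * (indicator {..d0} y * k y))" by simp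
  qed (use int_f in auto)
  also have "\<dots> = \<bar>f s\<bar> * (LINT y|lborel. indicator {..d0} y * k y)" by simp
  finally have "\<bar>a\<bar> / 2 * \<bar>f s\<bar> \<le> (LINT y|lborel. indicator {..d0} y * k y) * \<bar>f s\<bar>"
    by (simp add: mult.commute)
  then have "(\<bar>a\<bar> / 2 - (LINT y|lborel. indicator {..d0} y * k y)) * \<bar>f s\<bar> \<le> 0"
    by (simp add: algebra_simps)
  with d0(2) have fs: "f s = 0" by (simp add: mult_le_0_iff)
  have "f x = 0" if "x \<le> a + d" for x
    using s(2)[of x] fs z[of x] that by (cases "x \<le> a") auto
  then show ?thesis using d(1) by blast
qed

text \<open>The maximal left half-line of zeros cannot be extended, so by
  \<open>vanishes_extend\<close> it ends at 0; a point with f nonzero keeps its supremum finite. The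
  second claim provides points of definite sign arbitrarily close to 0.\<close>

lemma support:
  assumes "f x0 \<noteq> 0"
  shows "\<And>x. x \<le> 0 \<Longrightarrow> f x = 0" and "\<And>a. 0 < a \<Longrightarrow> \<exists>x. 0 < x \<and> x < a \<and> f x \<noteq> 0"
proof -
  define A where "A = {a. \<forall>x\<le>a. f x = 0}"
  have ne: "A \<noteq> {}" using vanishes_left by (auto simp: A_def)
  have ub: "a \<le> x0" if "a \<in> A" for a using that assms unfolding A_def by (rule_tac ccontr) (auto simp: not_le)
  then have bdd: "bdd_above A" by (auto intro!: bdd_aboveI)
  have lt: "f x = 0" if "x < Sup A" for x
    by (rule less_cSupE[OF that ne]) (auto simp: A_def)
  have "f (Sup A) = 0"
  proof -
    have "((\<lambda>x. f x) \<longlongrightarrow> f (Sup A)) (at_left (Sup A))"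
      using f_isCont[of "Sup A"] by (simp add: isCont_def filterlim_at_split)
    moreover have "((\<lambda>x. f x) \<longlongrightarrow> 0) (at_left (Sup A))"
      by (rule tendsto_eventually) (auto simp: eventually_at_filter lt)
    ultimately show ?thesis by (rule tendsto_unique[OF trivial_limit_at_left_real])
  qed
  with lt have SupA: "\<And>x. x \<le> Sup A \<Longrightarrow> f x = 0" by (auto simp: order_le_less)
  have "Sup A = 0"
  proof (rule ccontr)
    assume "Sup A \<noteq> 0"
    from vanishes_extend[OF this SupA] obtain d where "d > 0" "Sup A + d \<in> A" by (auto simp: A_def)
    then show False using cSup_upper[OF _ bdd, of "Sup A + d"] by auto
  qed
  then show *: "f x = 0" if "x \<le> 0" for x using SupA that by auto
  fix a :: real assume "0 < a"
  then have "a / 2 \<notin> A" using cSup_upper[OF _ bdd, of "a/2"] \<open>Sup A = 0\<close> by auto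
  then obtain x where "x \<le> a / 2" "f x \<noteq> 0" by (auto simp: A_def)
  then show "\<exists>x. 0 < x \<and> x < a \<and> f x \<noteq> 0" using * \<open>0 < a\<close> by (intro exI[of _ x] conjI) (use *[of x] in \<open>auto simp: not_le[symmetric]\<close>)
qed

end

lemma first_nonpos:
  fixes h :: "real \<Rightarrow> real"
  assumes "continuous_on UNIV h" "a \<le> b" "h b \<le> 0"
  obtains s where "a \<le> s" "s \<le> b" "h s \<le> 0" "\<And>x. a \<le> x \<Longrightarrow> x < s \<Longrightarrow> 0 < h x"
proof -
  have "closed {x. h x \<le> 0}"
    using assms(1) by (intro closed_Collect_le continuous_on_const) auto
  then have "compact ({x. h x \<le> 0} \<inter> {a..b})" by (intro closed_Int_compact) auto
  moreover have "{x. h x \<le> 0} \<inter> {a..b} \<noteq> {}" using assms by auto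
  ultimately obtain s where s: "s \<in> {x. h x \<le> 0} \<inter> {a..b}"
      "\<And>t. t \<in> {x. h x \<le> 0} \<inter> {a..b} \<Longrightarrow> s \<le> t"
    using compact_attains_inf by metis
  show thesis
    by (rule that[of s]) (use s in \<open>fastforce simp: not_le[symmetric]\<close>)+
qed

context volterra
begin

lemma f1_zero:
  assumes z: "\<And>x. x \<le> 0 \<Longrightarrow> f x = 0" and x: "x \<le> 0"
  shows "f1 x = 0"
proof -
  have neg: "f1 x = 0" if "x < 0" for x
  proof -
    have "(f has_real_derivative 0) (at x)"
      by (rule has_field_derivative_transform_within_open[where f="\<lambda>_. 0" and S="{..<0}"])
        (use z that in auto)
    then show ?thesis using DERIV_unique[OF f_deriv] by blast
  qed
  have "((\<lambda>x. f1 x) \<longlongrightarrow> f1 0) (at_left 0)"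
    using f1_cont by (simp add: continuous_on_eq_continuous_at isCont_def filterlim_at_split)
  moreover have "((\<lambda>x. f1 x) \<longlongrightarrow> 0) (at_left 0)"
    by (rule tendsto_eventually) (auto simp: eventually_at_filter neg)
  ultimately have "f1 0 = 0" by (rule tendsto_unique[OF trivial_limit_at_left_real])
  with neg x show ?thesis by (cases "x = 0") auto
qed

lemma f_reflect_deriv: "((\<lambda>y. f (x - y)) has_real_derivative - f1 (x - y)) (at y)"
proof -
  have "((\<lambda>y. x - y) has_real_derivative - 1) (at y)" by (auto intro!: derivative_eq_intros)
  from DERIV_chain2[OF f_deriv this] show ?thesis by simp
qed

text \<open>\<open>kernel_by_parts\<close> with W y = f x - f (x - y), nonnegative at a running
  maximum, gives f x * k x \<le> f x + x * f1 x. So where the kernel still exceeds 1, f must be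
  rising.\<close>

lemma running_max:
  assumes z: "\<And>x. x \<le> 0 \<Longrightarrow> f x = 0" and x: "0 < x" and max: "\<And>y. 0 < y \<Longrightarrow> y < x \<Longrightarrow> f y \<le> f x"
    and fx: "0 < f x" and kx: "1 < k x"
  shows "0 < f1 x"
proof -
  have "(f x - f (x - x)) * k x \<le> (LINT y|lborel. f1 (x - y) * k y * indicator {0..x} y)"
  proof (rule kernel_by_parts[where W="\<lambda>y. f x - f (x - y)"])
    show "((\<lambda>y. f x - f (x - y)) has_real_derivative f1 (x - y)) (at y)" for y
      by (auto intro!: derivative_eq_intros f_reflect_deriv)
    show "continuous_on UNIV (\<lambda>y. f1 (x - y))"
      by (intro continuous_on_compose2[OF f1_cont] continuous_intros) auto
  qed (use x max in auto)
  also have "\<dots> = (LINT y|lborel. f1 (x - y) * k y)"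
  proof (rule Bochner_Integration.integral_cong[OF refl])
    show "f1 (x - y) * k y * indicator {0..x} y = f1 (x - y) * k y" for y
      using k_nonpos[of y] f1_zero[OF z, of "x - y"] by (cases "y < 0"; cases "x < y") auto
  qed
  also have "\<dots> = f x + x * f1 x" by (simp add: f1_eq)
  finally have "f x * (k x - 1) \<le> x * f1 x" using z[of 0] by (simp add: algebra_simps)
  moreover have "0 < f x * (k x - 1)" using fx kx by simp
  ultimately show ?thesis using x by (metis less_le_trans zero_less_mult_pos)
qed

text \<open>The maximum of f on [0, x] is attained at a running maximum s with k s \<ge> k x > 1.
  There f has positive slope, which is impossible unless s = x.\<close>

lemma initial_increase:
  assumes z: "\<And>x. x \<le> 0 \<Longrightarrow> f x = 0" and kx: "1 < k x" and y: "0 < y" "y \<le> x" "0 < f y"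
  shows "0 < f x" "0 < f1 x"
proof -
  obtain s where s: "s \<in> {0..x}" "\<And>y. y \<in> {0..x} \<Longrightarrow> f y \<le> f s"
    using continuous_attains_sup[of "{0..x}" f] y f_cont by force
  have fs: "0 < f s" using s(2)[of y] y by auto
  then have s0: "0 < s" using z[of s] by force
  have "1 < k s" using k_le[OF s0, of x] s(1) kx by auto
  then have f1s: "0 < f1 s"
    using s s0 fs by (intro running_max z) auto
  have "s = x"
  proof (rule ccontr)
    assume "s \<noteq> x"
    then have "s < x" using s by auto
    moreover obtain d where "d > 0" "\<And>h. 0 < h \<Longrightarrow> h < d \<Longrightarrow> f s < f (s + h)"
      using DERIV_pos_inc_right[OF f_deriv f1s] by blast
    ultimately show False
      using s(2)[of "s + min (d/2) (x - s)"] s0 \<open>s < x\<close>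
      by (smt (verit) atLeastAtMost_iff field_sum_of_halves)
  qed
  with fs f1s show "0 < f x" "0 < f1 x" by auto
qed

text \<open>At a first nonpositive value s, the convolution s * f s would average strictly positive
  values only.\<close>

lemma positive_propagates:
  assumes z: "\<And>x. x \<le> 0 \<Longrightarrow> f x = 0" and d: "0 < d" "\<And>x. 0 < x \<Longrightarrow> x \<le> d \<Longrightarrow> 0 < f x" and x: "0 < x"
  shows "0 < f x"
proof (rule ccontr)
  assume "\<not> 0 < f x"
  with d x have "d \<le> x" "f x \<le> 0" by (force simp: not_less)+
  then obtain s where s: "d \<le> s" "s \<le> x" "f s \<le> 0" "\<And>x. d \<le> x \<Longrightarrow> x < s \<Longrightarrow> 0 < f x"
    using first_nonpos[OF f_cont] by metis
  have pos: "0 < f y" if "0 < y" "y < s" for y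
    using d(2)[of y] s(4)[of y] that by linarith
  have "0 < (LINT y|lborel. f (s - y) * k y)"
  proof (rule lborel_integral_pos[OF int_f, of s 0 s])
    show "0 \<le> f (s - y) * k y" for y
    proof -
      consider "y \<le> 0" | "s \<le> y" | "0 < y" "y < s" by linarith
      then show ?thesis using pos[of "s - y"] z k_nonpos k_nonneg[of y] by cases auto
    qed
  qed (use pos k_pos s(1) d(1) in auto)
  then show False using s d(1) by (simp flip: f_eq add: zero_less_mult_iff)
qed

end

lemma (in volterra) volterra_uminus: "volterra k k' (\<lambda>x. - f x) (\<lambda>x. - f1 x) B"
  by unfold_locales
    (use f_bound f1_bound f_eq in \<open>auto intro!: continuous_intros f1_cont DERIV_minus f_deriv\<close>)

text \<open>A positive value at y excludes negative values at smaller t, since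
  \<open>initial_increase\<close> for the negated solution would carry such a value from t to y. As
  f has nonzero values arbitrarily near 0, these are positive; \<open>initial_increase\<close>
  spreads positivity over (0, d], and \<open>positive_propagates\<close> over the half-line.\<close>

lemma (in volterra) one_sign:
  assumes nz: "f x0 \<noteq> 0"
  shows "(\<forall>x>0. 0 < f x) \<or> (\<forall>x>0. f x < 0)"
proof -
  have pos: "\<forall>x>0. 0 < g x"
    if "volterra k k' g g1 B" and z: "\<And>x. x \<le> 0 \<Longrightarrow> g x = 0"
      and nz: "\<And>a. 0 < a \<Longrightarrow> \<exists>x. 0 < x \<and> x < a \<and> g x \<noteq> 0"
      and d: "0 < d" "1 < k d" and y: "0 < y" "y \<le> d" "0 < g y" for g g1 y d
  proof -
    interpret g: volterra k k' g g1 B by fact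
    interpret ng: volterra k k' "\<lambda>x. - g x" "\<lambda>x. - g1 x" B by (rule g.volterra_uminus)
    have kd: "1 < k x" if "0 < x" "x \<le> d" for x using k_le[OF that] d by auto
    have "0 < g x" if x: "0 < x" "x \<le> d" for x
    proof -
      obtain t where t: "0 < t" "t < min x y" "g t \<noteq> 0" using nz[of "min x y"] x y by auto
      have "0 < g t"
        using ng.initial_increase(1)[of y t] kd[of y] z t y by force
      then show ?thesis using g.initial_increase(1)[OF z kd[OF x] t(1)] t by auto
    qed
    then show ?thesis using g.positive_propagates[OF z d(1)] by blast
  qed
  obtain d where d: "0 < d" "1 < k d" using k_large by auto
  obtain y where y: "0 < y" "y < d" "f y \<noteq> 0" using support(2)[OF nz d(1)] by auto
  show ?thesis
  proof (cases "0 < f y")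
    case True
    then show ?thesis
      using pos[OF volterra_axioms support(1)[OF nz] support(2)[OF nz] d y(1)] y by auto
  next
    case False
    then show ?thesis
      using pos[OF volterra_uminus _ _ d y(1)] support[OF nz] y by auto
  qed
qed

section \<open>Unimodality of positive solutions\<close>

locale positive_volterra = volterra +
  assumes f_zero: "x \<le> 0 \<Longrightarrow> f x = 0" and f_pos: "0 < x \<Longrightarrow> 0 < f x"
begin

lemmas f1_nonpos_zero = f1_zero[OF f_zero]

text \<open>The integrand of x * f1 x, obtained from \<open>f1_eq\<close> by writing f x as the
  integral of f1 (x - y). At the single point y = 0 the convention k 0 = 0 leaves - f1 x, hence the
  separate case y = 0 below.\<close>

definition D :: "real \<Rightarrow> real \<Rightarrow> real"
  where "D x y = f1 (x - y) * (k y - 1) * indicator {0..x} y"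

lemma cont_shift: "continuous_on S (\<lambda>y. f1 (x - y))"
  by (intro continuous_on_compose2[OF f1_cont] continuous_intros) auto

lemma int_shift: "integrable lborel (\<lambda>y. f1 (x - y) * indicator {0..x} y)"
  using borel_integrable_atLeastAtMost'[OF cont_shift, of 0 x x]
  by (simp add: set_integrable_def mult.commute)

lemma f_primitive:
  assumes "0 \<le> x"
  shows "f x = (LINT y|lborel. f1 (x - y) * indicator {0..x} y)"
proof -
  have "(LINT y|lborel. indicator {0..x} y *\<^sub>R f1 (x - y)) = (- f (x - x)) - (- f (x - 0))"
    by (rule integral_FTC_atLeastAtMost[OF assms])
      (auto intro!: cont_shift derivative_eq_intros has_field_derivative_at_within[OF f_reflect_deriv]
        simp: has_real_derivative_iff_has_vector_derivative[symmetric])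
  then show ?thesis using f_zero[of 0] by (simp add: mult.commute)
qed

lemma D_eq: "D x y = f1 (x - y) * k y - f1 (x - y) * indicator {0..x} y"
proof -
  consider "y < 0" | "0 \<le> y" "y \<le> x" | "0 \<le> y" "x < y" by linarith
  then show ?thesis
    using f1_nonpos_zero[of "x - y"] k_nonpos[of y]
    by cases (auto simp: D_def indicator_def algebra_simps)
qed

lemma int_D: "integrable lborel (D x)"
  using Bochner_Integration.integrable_diff[OF int_f1 int_shift] by (simp add: D_eq[abs_def])

lemma integral_D: "0 \<le> x \<Longrightarrow> x * f1 x = integral\<^sup>L lborel (D x)"
  using Bochner_Integration.integral_diff[OF int_f1[of x] int_shift[of x]]
  by (simp add: D_eq[abs_def] f1_eq[symmetric] f_primitive[symmetric])

lemma initial_f1_pos: "0 < x \<Longrightarrow> 1 < k x \<Longrightarrow> 0 < f1 x"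
  using initial_increase(2)[OF f_zero, of x x] f_pos by auto

text \<open>f rises near 0, where the kernel exceeds 1. It cannot rise for ever: with K the mass of
  the kernel, the equation at x = K + 1 would give (K + 1) * f x \<le> K * f x.\<close>

lemma first_critical:
  obtains m where "0 < m" "f1 m = 0" "\<And>x. 0 < x \<Longrightarrow> x < m \<Longrightarrow> 0 < f1 x"
proof -
  obtain d where d: "0 < d" "1 < k d" using k_large by auto
  have near: "0 < f1 x" if "0 < x" "x \<le> d" for x
    using initial_f1_pos[of x] k_le[OF that] that d by auto
  have "\<exists>b>0. f1 b \<le> 0"
  proof (rule ccontr)
    assume "\<not> ?thesis"
    then have up: "0 < f1 x" if "0 < x" for x using that by force
    define K where "K = (LINT y|lborel. k y)"
    have K0: "0 \<le> K" unfolding K_def using k_nonneg by simp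
    have le: "f y \<le> f (K + 1)" if "0 < y" "y \<le> K + 1" for y
      by (rule DERIV_nonneg_imp_nondecreasing) (use that up f_deriv in \<open>auto intro!: exI[of _ "f1 _"] less_imp_le\<close>)
    have "(K + 1) * f (K + 1) \<le> (LINT y|lborel. f (K + 1) * k y)"
      unfolding f_eq
    proof (rule integral_mono)
      show "f (K + 1 - y) * k y \<le> f (K + 1) * k y" for y
      proof -
        consider "y \<le> 0" | "0 < y" "y < K + 1" | "0 < y" "K + 1 \<le> y" by linarith
        then show ?thesis
          using le[of "K + 1 - y"] k_nonpos[of y] k_nonneg[of y] f_zero[of "K + 1 - y"] f_pos[of "K + 1"] K0
          by cases (auto intro!: mult_right_mono)
      qed
    qed (use int_f k_int in auto)
    then show False using f_pos[of "K + 1"] K0 by (simp add: K_def[symmetric] algebra_simps)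
  qed
  then obtain b where b: "0 < b" "f1 b \<le> 0" by auto
  then have "d \<le> b" using near[of b] by force
  from first_nonpos[OF f1_cont this b(2)] obtain s where
    s: "d \<le> s" "f1 s \<le> 0" "\<And>x. d \<le> x \<Longrightarrow> x < s \<Longrightarrow> 0 < f1 x" by metis
  have pos: "0 < f1 x" if "0 < x" "x < s" for x using near[of x] s(3)[of x] that by linarith
  have "((\<lambda>x. f1 x) \<longlongrightarrow> f1 s) (at_left s)"
    using f1_cont by (simp add: continuous_on_eq_continuous_at isCont_def filterlim_at_split)
  moreover have "\<forall>\<^sub>F x in at_left s. 0 \<le> f1 x"
    using eventually_at_left_real[of 0 s] s(1) d(1)
    by (auto elim!: eventually_mono intro!: less_imp_le pos)
  ultimately have "0 \<le> f1 s" by (intro tendsto_lowerbound) auto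
  with s d(1) pos show thesis by (intro that[of s]) auto
qed

text \<open>Compare the identity \<open>integral_D\<close> at \<open>x\<close> with its copy at the critical point \<open>m\<close>, shifted
  by \<open>x - m\<close>: on the increasing branch of \<open>f\<close> the kernel only gets smaller.\<close>

lemma past_critical:
  assumes m: "0 < m" "f1 m = 0" "\<And>x. 0 < x \<Longrightarrow> x < m \<Longrightarrow> 0 < f1 x" and x: "m < x"
  shows "x * f1 x < (LINT y|lborel. D x y * indicator {0..x - m} y)"
proof -
  let ?t = "x - m"
  have intS: "integrable lborel (\<lambda>y. D m (y - ?t))"
    using lborel_integrable_real_affine[OF int_D[of m], of 1 "- ?t"] by (simp add: algebra_simps)
  have intI: "integrable lborel (\<lambda>y. D x y * indicator {0..?t} y)"
    using integrable_mult_indicator[of "{0..?t}" lborel "D x"] int_D by (simp add: mult.commute)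
  have "(LINT y|lborel. D m (y - ?t)) = integral\<^sup>L lborel (D m)"
    using lborel_integral_real_affine[of 1 "D m" "- ?t"] by (simp add: algebra_simps)
  then have S0: "(LINT y|lborel. D m (y - ?t)) = 0" using integral_D[of m] m by simp
  \<comment> \<open>The negated part of \<open>D x\<close> beyond ?t, plus the shifted
    \<open>D m\<close>, whose integral vanishes. For y > ?t both carry the same factor f1 (x - y),
    taken on the rising branch, and only the kernel arguments y and y - ?t differ.\<close>
  let ?h = "\<lambda>y. D x y * indicator {0..?t} y - D x y + D m (y - ?t)"
  have h_gt: "?h y = f1 (x - y) * (k (y - ?t) - k y)" if "?t < y" "y \<le> x" for y
    using that x by (auto simp: D_def indicator_def algebra_simps)
  have h_pos: "0 < ?h y" if "?t < y" "y < x" for y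
    using that x m(3)[of "x - y"] k_less[of "y - ?t" y] m(1) by (simp only: h_gt less_imp_le) simp
  have "0 < integral\<^sup>L lborel ?h"
  proof (rule lborel_integral_pos[of _ ?t x])
    show "0 \<le> ?h y" for y
    proof -
      consider "y < ?t" | "y = ?t" | "?t < y" "y < x" | "y = x" | "x < y" by linarith
      then show ?thesis
      proof cases
        case 4
        then show ?thesis using h_gt[of y] m(1) f1_nonpos_zero[of 0] by simp
      qed (use h_pos[of y] m(1,2) x in \<open>auto simp: D_def indicator_def\<close>)
    qed
  qed (use h_pos x m(1) int_D intS intI in auto)
  also have "integral\<^sup>L lborel ?h = (LINT y|lborel. D x y * indicator {0..?t} y) - x * f1 x"
    using int_D intS intI S0 x m(1) by (simp add: integral_D)
  finally show ?thesis by simp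
qed

text \<open>The bound of \<open>past_critical\<close> involves f1 only on [m, x]. It first shows
  that f1 is negative just after m. Then a first return s of f1 to a nonnegative value is refuted,
  by the same bound or by comparing the kernel with the constant k (s - m).\<close>

theorem unimodal:
  "\<exists>m>0. (\<forall>x. 0 < x \<and> x < m \<longrightarrow> 0 < f1 x) \<and> f1 m = 0 \<and> (\<forall>x>m. f1 x < 0)"
proof -
  obtain m where m: "0 < m" "f1 m = 0" "\<And>x. 0 < x \<Longrightarrow> x < m \<Longrightarrow> 0 < f1 x"
    using first_critical by metis
  \<comment> \<open>d1 makes k y - 1 a nonnegative weight on the window; d2 keeps the kernel mass
    there below m, to be played against the factor s > m on the left of the bound.\<close>
  obtain d1 where d1: "0 < d1" "1 < k d1" using k_large by auto
  obtain d2 where d2: "0 < d2" "(LINT y|lborel. indicator {..d2} y * k y) < m"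
    using mass_small[OF m(1)] by auto
  define d where "d = min d1 d2"
  have d: "0 < d" "d \<le> d1" "d \<le> d2" using d1 d2 by (auto simp: d_def)
  have kd: "1 < k y" if "0 < y" "y \<le> d" for y using k_le[of y d1] that d d1 by auto
  have near: "f1 x < 0" if x: "m < x" "x \<le> m + d" for x
  proof (rule ccontr)
    assume "\<not> ?thesis"
    then have fx: "0 \<le> f1 x" by simp
    \<comment> \<open>\<open>past_critical\<close> needs s > m. If the maximum of f1 on [m, x] sits
      at m, where f1 vanishes, then x attains it as well.\<close>
    have "\<exists>s. m < s \<and> s \<le> x \<and> 0 \<le> f1 s \<and> (\<forall>y\<in>{m..x}. f1 y \<le> f1 s)"
    proof -
      obtain s where s: "s \<in> {m..x}" "\<And>y. y \<in> {m..x} \<Longrightarrow> f1 y \<le> f1 s"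
        using continuous_attains_sup[of "{m..x}" f1] x continuous_on_subset[OF f1_cont] by force
      show ?thesis
      proof (cases "s = m")
        case True
        then show ?thesis using s x m(2) fx by (intro exI[of _ x]) force
      next
        case False
        then show ?thesis using s s(2)[of x, THEN order_trans[OF fx]] x by (intro exI[of _ s]) auto
      qed
    qed
    then obtain s where s: "m < s" "s \<le> x" "0 \<le> f1 s" "\<And>y. y \<in> {m..x} \<Longrightarrow> f1 y \<le> f1 s" by auto
    have "s * f1 s < (LINT y|lborel. D s y * indicator {0..s - m} y)"
      using past_critical[OF m s(1)] .
    also have "\<dots> \<le> (LINT y|lborel. f1 s * (indicator {..d2} y * k y))"
    proof (rule integral_mono)
      show "integrable lborel (\<lambda>y. D s y * indicator {0..s - m} y)"
        using integrable_mult_indicator[of "{0..s-m}" lborel "D s"] int_D by (simp add: mult.commute)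
      show "integrable lborel (\<lambda>y. f1 s * (indicator {..d2} y * k y))"
        using integrable_mult_indicator[of "{..d2}" lborel k] k_int by simp
      show "D s y * indicator {0..s - m} y \<le> f1 s * (indicator {..d2} y * k y)" for y
      proof -
        consider "y < 0 \<or> s - m < y" | "y = 0" | "0 < y" "y \<le> s - m" by linarith
        then show ?thesis
        proof cases
          case 1
          then show ?thesis using s(3) k_nonneg[of y] by (auto simp: indicator_def)
        next
          case 2
          then show ?thesis using s k_nonpos[of 0] m(1) by (simp add: D_def)
        next
          case 3
          then have "f1 (s - y) * (k y - 1) \<le> f1 s * (k y - 1)"
            using s kd[of y] x by (intro mult_right_mono) auto
          also have "\<dots> \<le> f1 s * k y" using s(3) by (intro mult_left_mono) auto
          finally show ?thesis using 3 s x d m(1) by (simp add: D_def indicator_def)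
        qed
      qed
    qed
    also have "\<dots> = f1 s * (LINT y|lborel. indicator {..d2} y * k y)" by simp
    also have "\<dots> \<le> f1 s * m" using d2 s(3) by (intro mult_left_mono) auto
    also have "\<dots> \<le> f1 s * s" using s by (intro mult_left_mono) auto
    finally show False by (simp add: mult.commute)
  qed
  have "f1 x < 0" if x: "m < x" for x
  proof (rule ccontr)
    assume fx: "\<not> ?thesis"
    then have "m + d \<le> x" using near[of x] x by force
    moreover have "continuous_on UNIV (\<lambda>x. - f1 x)" by (intro continuous_intros f1_cont)
    moreover have "- f1 x \<le> 0" using fx by simp
    ultimately obtain s where s': "m + d \<le> s" "- f1 s \<le> 0" "\<And>x. m + d \<le> x \<Longrightarrow> x < s \<Longrightarrow> 0 < - f1 x"
      using first_nonpos by metis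
    then have s: "m + d \<le> s" "0 \<le> f1 s" "\<And>x. m + d \<le> x \<Longrightarrow> x < s \<Longrightarrow> f1 x < 0" by auto
    have neg: "f1 y < 0" if "m < y" "y < s" for y using near[of y] s(3)[of y] that by linarith
    \<comment> \<open>If k \<ge> 1 up to s - m, then f1 < 0 on (m, s) makes the bound of
      \<open>past_critical\<close> nonpositive. Otherwise the full equation for f1 is used.\<close>
    show False
    proof (cases "1 \<le> k (s - m)")
      case True
      have np: "D s y * indicator {0..s - m} y \<le> 0" for y
      proof -
        consider "y < 0 \<or> s - m < y" | "y = 0" | "0 < y" "y < s - m" | "y = s - m" by linarith
        then show "D s y * indicator {0..s - m} y \<le> 0"
        proof cases
          case 3
          then have "1 \<le> k y" using k_le[of y "s - m"] True by auto
          then show ?thesis using 3 neg[of "s - y"]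
            by (auto simp: D_def indicator_def intro!: mult_nonpos_nonneg)
        qed (use s m k_nonpos[of 0] in \<open>auto simp: D_def indicator_def\<close>)
      qed
      have "s * f1 s < (LINT y|lborel. D s y * indicator {0..s - m} y)"
        using past_critical[OF m, of s] s(1) d(1) by auto
      also have "\<dots> \<le> 0"
        using Bochner_Integration.integral_nonneg[of lborel "\<lambda>y. - (D s y * indicator {0..s - m} y)"] np by simp
      finally show False using s m(1) d(1) by (simp add: mult_less_0_iff)
    next
      case False
      \<comment> \<open>For y between 0 and s, f1 (s - y) and k y - ?c have opposite signs: both
        change sign at y = s - m. So replacing k by ?c only increases the integral, which then
        equals ?c * f s with ?c < 1.\<close>
      let ?c = "k (s - m)"
      have "f s + s * f1 s \<le> (LINT y|lborel. ?c * (f1 (s - y) * indicator {0..s} y))"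
        unfolding f1_eq
      proof (rule integral_mono)
        fix y
        consider "y < 0 \<or> s \<le> y" | "y = 0" | "0 < y" "y < s - m" | "y = s - m" | "s - m < y" "y < s" by linarith
        then show "f1 (s - y) * k y \<le> ?c * (f1 (s - y) * indicator {0..s} y)"
        proof cases
          case 1
          then show ?thesis using k_nonpos[of y] f1_nonpos_zero[of "s - y"] by (auto simp: indicator_def)
        next
          case 2
          then show ?thesis using k_nonpos[of 0] s k_nonneg[of "s - m"] by (auto simp: indicator_def)
        next
          case 3
          then show ?thesis
            using neg[of "s - y"] k_le[of y "s - m"] m(1)
            by (auto simp: indicator_def mult.commute[of ?c] intro!: mult_left_mono_neg)
        next
          case 4
          then show ?thesis using m by simp
        next
          case 5
          then show ?thesis
            using m(3)[of "s - y"] k_le[of "s - m" y] s(1) d(1)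
            by (auto simp: indicator_def mult.commute[of ?c] intro!: mult_left_mono)
        qed
      qed (use int_f1 int_shift in auto)
      also have "\<dots> = ?c * f s" using f_primitive[of s] s(1) m(1) d(1) by simp
      finally have "s * f1 s \<le> (?c - 1) * f s" by (simp add: algebra_simps)
      moreover have "(?c - 1) * f s < 0" using False f_pos[of s] s(1) m(1) d(1) by (simp add: mult_less_0_iff)
      moreover have "0 \<le> s * f1 s" using s m(1) d(1) by auto
      ultimately show False by linarith
    qed
  qed
  with m show ?thesis by blast
qed

end

section \<open>Tempered kernels and exponential tilting\<close>

definition ts_weight :: "real \<Rightarrow> real \<Rightarrow> real \<Rightarrow> real \<Rightarrow> real" where
  "ts_weight \<alpha> \<beta> l x = \<alpha> / x powr (1 + \<beta>) * exp (- l * x) * indicator {0<..} x"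

text \<open>For beta > 0 the Levy density is not integrable at 0, but x times it is; this product
  also appears when the characteristic exponent is differentiated.\<close>

definition ts_kernel :: "real \<Rightarrow> real \<Rightarrow> real \<Rightarrow> real \<Rightarrow> real" where
  "ts_kernel \<alpha> \<beta> l x = x * ts_weight \<alpha> \<beta> l x"

definition ts_kernel' :: "real \<Rightarrow> real \<Rightarrow> real \<Rightarrow> real \<Rightarrow> real" where
  "ts_kernel' \<alpha> \<beta> l x = - \<alpha> * (\<beta> * x powr (- \<beta> - 1) + l * x powr (- \<beta>)) * exp (- l * x)"

locale tempered =
  fixes \<alpha> \<beta> l :: real
  assumes \<alpha>: "0 < \<alpha>" and \<beta>: "0 < \<beta>" "\<beta> < 1" and l: "0 < l"
begin

abbreviation "w \<equiv> ts_weight \<alpha> \<beta> l"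
abbreviation "k \<equiv> ts_kernel \<alpha> \<beta> l"
abbreviation "k' \<equiv> ts_kernel' \<alpha> \<beta> l"

lemma w_meas [measurable]: "w \<in> borel_measurable borel"
  unfolding ts_weight_def[abs_def] by measurable

lemma k_meas [measurable]: "k \<in> borel_measurable borel"
  unfolding ts_kernel_def[abs_def] by measurable

lemma w_nonneg: "0 \<le> w x"
  using \<alpha> by (simp add: ts_weight_def)

lemma k_eq: "0 < x \<Longrightarrow> k x = \<alpha> * x powr (- \<beta>) * exp (- l * x)"
  by (simp add: ts_kernel_def ts_weight_def powr_add powr_minus field_simps)

text \<open>The substitution t = l * x turns this into the Euler integral for Gamma (1 - beta),
  finite because beta < 1.\<close>

lemma k_integrable: "integrable lborel k"
proof -
  define g where "g t = indicator {0..} t * t powr ((1 - \<beta>) - 1) / exp t" for t :: real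
  have [measurable]: "g \<in> borel_measurable borel" unfolding g_def[abs_def] by measurable
  have "integrable lborel g"
  proof (rule integrableI_nonneg)
    have "(\<integral>\<^sup>+t. ennreal (g t) \<partial>lborel) = Gamma (1 - \<beta>)"
      unfolding g_def using \<beta> by (subst Gamma_conv_nn_integral_real) auto
    then show "(\<integral>\<^sup>+t. ennreal (g t) \<partial>lborel) < \<infinity>" by simp
  qed (auto simp: g_def)
  then have "integrable lborel (\<lambda>x. (\<alpha> * l powr \<beta>) * g (0 + l * x))"
    using l lborel_integrable_real_affine[of g l 0] by simp
  also have "(\<lambda>x. (\<alpha> * l powr \<beta>) * g (0 + l * x)) = k"
  proof
    fix x :: real
    consider "x < 0" | "x = 0" | "0 < x" by linarith
    then show "(\<alpha> * l powr \<beta>) * g (0 + l * x) = k x"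
    proof cases
      case 1
      then show ?thesis using l by (simp add: g_def ts_kernel_def ts_weight_def indicator_def zero_le_mult_iff)
    next
      case 2
      then show ?thesis by (simp add: g_def ts_kernel_def)
    next
      case 3
      then show ?thesis using l
        by (simp add: g_def k_eq powr_mult powr_minus exp_minus field_simps)
    qed
  qed
  finally show ?thesis .
qed

text \<open>beta > 0 makes k blow up at 0, which gives \<open>k_large\<close>; beta < 1 gives
  \<open>k_small\<close> and integrability.\<close>

lemma kernel: "decreasing_kernel k k'"
proof
  show "k x = 0" if "x \<le> 0" for x using that by (simp add: ts_kernel_def ts_weight_def indicator_def)
  show "0 < k x" if "0 < x" for x using that \<alpha> by (simp add: k_eq)
  show "(k has_real_derivative k' x) (at x)" if "0 < x" for x
  proof (rule has_field_derivative_transform_within_open[where S="{0<..}" and f="\<lambda>x. \<alpha> * x powr (- \<beta>) * exp (- l * x)"])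
    show "((\<lambda>x. \<alpha> * x powr (- \<beta>) * exp (- l * x)) has_real_derivative k' x) (at x)"
      using that by (auto intro!: derivative_eq_intros simp: ts_kernel'_def algebra_simps)
  qed (use that in \<open>auto simp: k_eq\<close>)
  show "k' x < 0" if "0 < x" for x
  proof -
    have "0 < \<beta> * x powr (- \<beta> - 1) + l * x powr (- \<beta>)"
      using that \<beta> l by (intro add_pos_pos) auto
    then show ?thesis using \<alpha> unfolding ts_kernel'_def
      by (simp add: mult_neg_pos)
  qed
  show "integrable lborel k" by (rule k_integrable)
  have *: "LIM x at_right 0. \<alpha> * x powr (- \<beta>) * exp (- l * x) :> at_top"
    using \<alpha> \<beta> l by real_asymp
  have "\<forall>\<^sub>F x in at_right 0. 1 < \<alpha> * x powr (- \<beta>) * exp (- l * x)"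
    using * by (rule filterlim_at_top_dense[THEN iffD1, rule_format])
  then have "\<forall>\<^sub>F x in at_right 0. 0 < x \<and> 1 < k x"
    using eventually_at_right_less[of 0] by eventually_elim (simp add: k_eq)
  from eventually_happens'[OF trivial_limit_at_right_real this] show "\<exists>d>0. 1 < k d" by auto
  have "((\<lambda>x. x * (\<alpha> * x powr (- \<beta>) * exp (- l * x))) \<longlongrightarrow> 0) (at_right 0)"
    using \<alpha> \<beta> l by real_asymp
  then show "((\<lambda>x. x * k x) \<longlongrightarrow> 0) (at_right 0)"
    by (rule Lim_transform_eventually) (auto simp: eventually_at_filter k_eq)
qed

end

lemma tempered_tilt: "tempered \<alpha> \<beta> l \<Longrightarrow> 0 \<le> c \<Longrightarrow> tempered \<alpha> \<beta> (l + c)"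
  by (auto simp: tempered_def)

lemma ts_kernel_tilt: "ts_kernel \<alpha> \<beta> (l + c) x = exp (- c * x) * ts_kernel \<alpha> \<beta> l x"
  by (simp add: ts_kernel_def ts_weight_def algebra_simps flip: exp_add)

locale tempered_volterra = tempered \<alpha> \<beta> l + positive_volterra "ts_kernel \<alpha> \<beta> l" "ts_kernel' \<alpha> \<beta> l" f f1 B
  for \<alpha> \<beta> l f f1 B
begin

text \<open>Exponential tilting by \<open>exp (- c * x)\<close> keeps the equation within the tempered family,
  so every tilt is unimodal as well. This is how log-concavity to the left of the mode enters.\<close>

theorem tilted_unimodal:
  assumes c: "0 \<le> c"
  shows "\<exists>m>0. (\<forall>x. 0 < x \<and> x < m \<longrightarrow> c * f x < f1 x) \<and> f1 m = c * f m \<and> (\<forall>x>m. f1 x < c * f x)"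
proof -
  define g where "g x = exp (- c * x) * f x" for x
  define g1 where "g1 x = exp (- c * x) * (f1 x - c * f x)" for x
  \<comment> \<open>The tilting factor is unbounded on the negative half-line; the tilted functions
    stay bounded because f and f1 vanish there.\<close>
  have bnd: "\<bar>exp (- c * x) * h\<bar> \<le> B + c * B" if "\<bar>h\<bar> \<le> B + c * B" "x \<le> 0 \<Longrightarrow> h = 0" for h x
  proof (cases "x \<le> 0")
    case False
    then have "exp (- c * x) * \<bar>h\<bar> \<le> 1 * \<bar>h\<bar>" using c by (intro mult_right_mono) auto
    then show ?thesis using that(1) by (simp add: abs_mult)
  qed (use that in auto)
  have B0: "0 \<le> B" using f_bound[of 0] by linarith
  have "tempered \<alpha> \<beta> (l + c)" using tempered_tilt[OF tempered_axioms c] .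
  then interpret t: decreasing_kernel "ts_kernel \<alpha> \<beta> (l + c)" "ts_kernel' \<alpha> \<beta> (l + c)"
    by (rule tempered.kernel)
  interpret t: positive_volterra "ts_kernel \<alpha> \<beta> (l + c)" "ts_kernel' \<alpha> \<beta> (l + c)" g g1 "B + c * B"
  proof
    show "(g has_real_derivative g1 x) (at x)" for x
      unfolding g_def g1_def by (auto intro!: derivative_eq_intros f_deriv simp: algebra_simps)
    show "continuous_on UNIV g1"
      unfolding g1_def by (intro continuous_intros f1_cont f_cont)
    show "\<bar>g x\<bar> \<le> B + c * B" for x
      unfolding g_def using f_bound[of x] f_zero[of x] B0 c by (intro bnd add_increasing2) auto
    show "\<bar>g1 x\<bar> \<le> B + c * B" for x
      unfolding g1_def
    proof (rule bnd)
      have "\<bar>f1 x - c * f x\<bar> \<le> \<bar>f1 x\<bar> + c * \<bar>f x\<bar>" using abs_triangle_ineq4[of "f1 x" "c * f x"] c by (simp add: abs_mult)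
      also have "\<dots> \<le> B + c * B" using f_bound f1_bound c by (intro add_mono mult_left_mono) auto
      finally show "\<bar>f1 x - c * f x\<bar> \<le> B + c * B" .
    qed (simp add: f_zero f1_nonpos_zero)
    show "x * g x = (LINT y|lborel. g (x - y) * ts_kernel \<alpha> \<beta> (l + c) y)" for x
    proof -
      \<comment> \<open>The exponential factors as exp (- c * x) = exp (- c * (x - y)) * exp (- c *
        y), one part for the solution and one for the kernel.\<close>
      have "g (x - y) * ts_kernel \<alpha> \<beta> (l + c) y = exp (- c * x) * (f (x - y) * ts_kernel \<alpha> \<beta> l y)" for y
        unfolding g_def ts_kernel_tilt by (simp add: algebra_simps exp_diff exp_minus field_simps)
      then have "(LINT y|lborel. g (x - y) * ts_kernel \<alpha> \<beta> (l + c) y) = exp (- c * x) * (x * f x)"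
        by (simp add: f_eq)
      then show ?thesis by (simp add: g_def)
    qed
  qed (auto simp: g_def f_zero f_pos)
  have sgn: "0 < g1 x \<longleftrightarrow> c * f x < f1 x" "g1 x = 0 \<longleftrightarrow> f1 x = c * f x" "g1 x < 0 \<longleftrightarrow> f1 x < c * f x" for x
    by (auto simp: g1_def zero_less_mult_iff mult_less_0_iff)
  show ?thesis using t.unimodal unfolding sgn .
qed

end

section \<open>The characteristic function\<close>

text \<open>Turns the stretched exponential bound on the characteristic function into polynomial
  decay of any order.\<close>

lemma exp_minus_le_power:
  assumes "0 < y" "0 < N"
  shows "exp (- y) \<le> (real N / y) ^ N"
proof -
  have "y / real N \<le> exp (y / real N)" using exp_ge_add_one_self[of "y / real N"] by linarith
  then have "(y / real N) ^ N \<le> exp (y / real N) ^ N" using assms by (intro power_mono) auto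
  also have "\<dots> = exp y" using assms by (simp flip: exp_of_nat_mult)
  finally have "(y / real N) ^ N \<le> exp y" .
  then show ?thesis using assms by (simp add: exp_minus field_simps power_divide)
qed

lemma integrable_inverse_1_plus_square_UNIV: "integrable lborel (\<lambda>x::real. inverse (1 + x\<^sup>2))"
  using integrable_inverse_1_plus_square by (simp add: set_integrable_def einterval_eq_UNIV)

lemma integral_derivative_vanishing:
  fixes G G' :: "real \<Rightarrow> 'a::euclidean_space"
  assumes "\<And>x. (G has_vector_derivative G' x) (at x)" "\<And>x. isCont G' x" "integrable lborel G'"
    and "(G \<longlongrightarrow> 0) at_top" "(G \<longlongrightarrow> 0) at_bot"
  shows "integral\<^sup>L lborel G' = 0"
proof -
  have "(LBINT x=-\<infinity>..\<infinity>. G' x) = 0 - 0"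
    by (rule interval_integral_FTC_integrable)
      (use assms in \<open>auto simp: set_integrable_def einterval_eq_UNIV ereal_tendsto_simps\<close>)
  then show ?thesis
    by (simp add: interval_lebesgue_integral_def set_lebesgue_integral_def einterval_eq_UNIV)
qed

lemma cmod_iexp_minus_1: "cmod (iexp x - 1) \<le> \<bar>x\<bar>"
  using iexp_approx1[of x 0] by simp

context tempered
begin

definition \<psi> :: "real \<Rightarrow> complex"
  where "\<psi> z = (CLINT x|lborel. (iexp (z * x) - 1) * of_real (w x))"

definition khat :: "real \<Rightarrow> complex"
  where "khat z = (CLINT x|lborel. iexp (z * x) * of_real (k x))"

definition \<phi> :: "real \<Rightarrow> complex" where "\<phi> z = exp (\<psi> z)"

lemma k_nonneg: "0 \<le> k x"
  by (rule decreasing_kernel.k_nonneg[OF kernel])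

lemma abs_w: "\<bar>x\<bar> * w x = k x"
  by (auto simp: ts_kernel_def ts_weight_def indicator_def)

lemma \<psi>_integrable: "integrable lborel (\<lambda>x. (iexp (z * x) - 1) * complex_of_real (w x))"
proof (rule Bochner_Integration.integrable_bound[where f="\<lambda>x. \<bar>z\<bar> * k x"])
  show "AE x in lborel. cmod ((iexp (z * x) - 1) * complex_of_real (w x)) \<le> norm (\<bar>z\<bar> * k x)"
  proof (intro AE_I2)
    fix x
    have "cmod (iexp (z * x) - 1) * w x \<le> \<bar>z * x\<bar> * w x"
      by (intro mult_right_mono cmod_iexp_minus_1 w_nonneg)
    then show "cmod ((iexp (z * x) - 1) * complex_of_real (w x)) \<le> norm (\<bar>z\<bar> * k x)"
      using k_nonneg[of x] w_nonneg[of x] by (simp add: norm_mult abs_mult mult.assoc abs_w)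
  qed
qed (use k_integrable in auto)

lemma cmod_khat: "cmod (khat z) \<le> (LINT x|lborel. k x)"
  unfolding khat_def using k_nonneg
  by (intro integral_norm_bound[THEN order_trans]) (simp add: norm_mult)

lemma \<psi>_deriv: "(\<psi> has_vector_derivative \<i> * khat z) (at z)"
proof -
  have "((\<lambda>z. CLINT x|lborel. (iexp (z * x) - 1) * of_real (w x)) has_vector_derivative
      (CLINT x|lborel. \<i> * (iexp (z * x) * of_real (k x)))) (at z)"
  proof (rule has_vector_derivative_lebesgue_integral[where w=k])
    show "((\<lambda>z. (iexp (z * x) - 1) * complex_of_real (w x)) has_vector_derivative
        \<i> * (iexp (z * x) * complex_of_real (k x))) (at z)" for x z
    proof -
      have "((\<lambda>z. (iexp (z * x) - 1) * complex_of_real (w x)) has_vector_derivative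
        (x *\<^sub>R (\<i> * iexp (z * x)) - 0) * complex_of_real (w x)) (at z)"
        by (intro has_vector_derivative_mult_left has_vector_derivative_diff has_vector_derivative_const
            vector_diff_chain_at[where f="\<lambda>z. z * x" and g=iexp, unfolded o_def] has_vector_derivative_iexp)
          (auto intro!: derivative_eq_intros simp: has_real_derivative_iff_has_vector_derivative[symmetric])
      then show ?thesis by (simp add: ts_kernel_def scaleR_conv_of_real mult_ac)
    qed
  qed (use \<psi>_integrable k_integrable k_nonneg in \<open>auto simp: norm_mult\<close>)
  then show ?thesis by (simp add: \<psi>_def[abs_def] khat_def)
qed

lemma khat_cont: "continuous_on UNIV khat"
  unfolding continuous_on_eq_continuous_within continuous_within_sequentially o_def khat_def
proof (intro ballI allI impI, elim conjE)
  fix a :: real and X :: "nat \<Rightarrow> real" assume X: "X \<longlonglongrightarrow> a"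
  show "(\<lambda>n. CLINT x|lborel. iexp (X n * x) * of_real (k x)) \<longlonglongrightarrow> (CLINT x|lborel. iexp (a * x) * of_real (k x))"
    by (rule integral_dominated_convergence[where w=k])
      (use k_integrable k_nonneg in \<open>auto simp: norm_mult intro!: tendsto_intros X\<close>)
qed

lemma \<phi>_deriv: "(\<phi> has_vector_derivative \<i> * khat z * \<phi> z) (at z)"
  using field_vector_diff_chain_at[OF \<psi>_deriv DERIV_exp, of z]
  by (simp add: \<phi>_def[abs_def] o_def)

lemma \<phi>_cont: "continuous_on S \<phi>"
  by (rule continuous_on_subset[OF _ subset_UNIV])
    (auto intro!: continuous_at_imp_continuous_on has_vector_derivative_continuous[OF \<phi>_deriv])

lemma \<phi>_meas [measurable]: "\<phi> \<in> borel_measurable borel"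
  by (rule borel_measurable_continuous_onI[OF \<phi>_cont])

lemma \<phi>_0: "\<phi> 0 = 1"
  by (simp add: \<phi>_def \<psi>_def)

lemma \<psi>_cnj: "cnj (\<psi> z) = \<psi> (- z)"
proof -
  have "\<psi> (- z) = (CLINT x|lborel. cnj ((iexp (z * x) - 1) * of_real (w x)))"
    unfolding \<psi>_def by (rule Bochner_Integration.integral_cong) (auto simp: exp_cnj)
  also have "\<dots> = cnj (\<psi> z)" unfolding \<psi>_def by (rule Bochner_Integration.integral_cnj)
  finally show ?thesis by (rule sym)
qed

lemma \<phi>_cnj: "cnj (\<phi> z) = \<phi> (- z)"
  by (simp add: \<phi>_def exp_cnj \<psi>_cnj)

lemma Re_\<psi>: "Re (\<psi> z) = - (LINT x|lborel. (1 - cos (z * x)) * w x)"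
proof -
  have "Re (\<psi> z) = (LINT x|lborel. Re ((iexp (z * x) - 1) * of_real (w x)))"
    unfolding \<psi>_def using \<psi>_integrable by (rule integral_Re[symmetric])
  also have "\<dots> = (LINT x|lborel. - ((1 - cos (z * x)) * w x))"
    by (rule Bochner_Integration.integral_cong) (auto simp: Re_exp algebra_simps)
  finally show ?thesis by simp
qed

lemma int_cos: "integrable lborel (\<lambda>x. (1 - cos (z * x)) * w x)"
proof -
  have "integrable lborel (\<lambda>x. - Re ((iexp (z * x) - 1) * of_real (w x)))"
    by (intro Bochner_Integration.integrable_minus integrable_Re \<psi>_integrable)
  also have "(\<lambda>x. - Re ((iexp (z * x) - 1) * of_real (w x))) = (\<lambda>x. (1 - cos (z * x)) * w x)"
    by (auto simp: Re_exp algebra_simps)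
  finally show ?thesis .
qed

lemma cmod_\<phi>_le_1: "cmod (\<phi> z) \<le> 1"
  using w_nonneg by (simp add: \<phi>_def Re_\<psi>)

text \<open>On the scale \<open>1 / z\<close> the integrand is comparable to \<open>x powr - (1 + \<beta>)\<close>.\<close>

lemma \<phi>_decay:
  obtains c where "0 < c" "\<And>z. 1 \<le> \<bar>z\<bar> \<Longrightarrow> cmod (\<phi> z) \<le> exp (- (c * \<bar>z\<bar> powr \<beta>))"
proof -
  define C where "C = (1 - cos (1 / 2)) * (\<alpha> * exp (- l))"
  have "cos (1 / 2 :: real) < cos 0" using pi_gt3 by (intro cos_monotone_0_pi) auto
  then have C0: "0 < C" unfolding C_def using \<alpha> by simp
  have "cmod (\<phi> z) \<le> exp (- (C / 2 * \<bar>z\<bar> powr \<beta>))" if z: "1 \<le> \<bar>z\<bar>" for z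
  proof -
    \<comment> \<open>Here \<bar>z\<bar> * x lies in [1/2, 1], which bounds 1 - cos from below, and
      x \<le> 1 bounds exp (- l * x). The length 1 / (2 * \<bar>z\<bar>) reduces the power 1 + beta
      to beta.\<close>
    let ?I = "{1 / (2 * \<bar>z\<bar>)..1 / \<bar>z\<bar>}"
    have low: "C * \<bar>z\<bar> powr (1 + \<beta>) * indicator ?I x \<le> (1 - cos (z * x)) * w x" for x
    proof (cases "x \<in> ?I")
      case True
      have x0: "0 < x" using True z by (auto intro: less_le_trans[of _ "1 / (2 * \<bar>z\<bar>)"])
      have zx: "1 / 2 \<le> \<bar>z\<bar> * x" "\<bar>z\<bar> * x \<le> 1" using True z by (auto simp: field_simps)
      have x1: "x \<le> 1" using True z by (auto intro: order_trans[of _ "1 / \<bar>z\<bar>"])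
      have "cos (z * x) = cos (\<bar>z\<bar> * x)" by (cases "0 \<le> z") auto
      also have "\<dots> \<le> cos (1 / 2)" using zx pi_gt3 by (intro cos_monotone_0_pi_le) auto
      finally have 1: "1 - cos (1 / 2) \<le> 1 - cos (z * x)" by simp
      have "\<bar>z\<bar> powr (1 + \<beta>) = inverse (\<bar>z\<bar> powr - (1 + \<beta>))" by (simp only: powr_minus inverse_inverse_eq)
      also have "\<dots> = (1 / \<bar>z\<bar>) powr - (1 + \<beta>)" by (simp add: powr_divide inverse_eq_divide)
      also have "\<dots> \<le> x powr - (1 + \<beta>)" using True x0 \<beta> by (intro powr_mono2') auto
      also have "\<dots> = 1 / x powr (1 + \<beta>)" using powr_minus[of x "1 + \<beta>"] by (simp add: inverse_eq_divide)
      finally have "\<alpha> * \<bar>z\<bar> powr (1 + \<beta>) * exp (- l) \<le> \<alpha> * (1 / x powr (1 + \<beta>)) * exp (- l * x)"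
        using \<alpha> l x0 x1 by (intro mult_mono mult_left_mono) auto
      then have 2: "\<alpha> * exp (- l) * \<bar>z\<bar> powr (1 + \<beta>) \<le> w x" using x0 by (simp add: ts_weight_def mult_ac)
      have "(1 - cos (1 / 2)) * (\<alpha> * exp (- l) * \<bar>z\<bar> powr (1 + \<beta>)) \<le> (1 - cos (z * x)) * w x"
        using 1 2 \<alpha> by (intro mult_mono) auto
      then show ?thesis using True by (simp add: C_def mult_ac)
    qed (use w_nonneg in auto)
    have len: "measure lborel ?I = 1 / (2 * \<bar>z\<bar>)"
      using z by (simp add: field_simps)
    have "C / 2 * \<bar>z\<bar> powr \<beta> = C * \<bar>z\<bar> powr (1 + \<beta>) * measure lborel ?I"
      unfolding len using z by (simp add: powr_add field_simps)
    also have "\<dots> = (LINT x|lborel. C * \<bar>z\<bar> powr (1 + \<beta>) * indicator ?I x)" by simp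
    also have "\<dots> \<le> (LINT x|lborel. (1 - cos (z * x)) * w x)"
      by (rule integral_mono[OF _ int_cos low])
        (auto intro!: integrable_mult_right integrable_real_indicator simp: emeasure_lborel_Icc_eq)
    finally show ?thesis by (simp add: \<phi>_def Re_\<psi>)
  qed
  then show thesis using C0 by (intro that[of "C / 2"]) auto
qed

lemma \<phi>_rapid_decay: "\<exists>C. \<forall>z. \<bar>z\<bar> ^ n * cmod (\<phi> z) \<le> C * inverse (1 + z\<^sup>2)"
proof -
  obtain c where c: "0 < c" "\<And>z. 1 \<le> \<bar>z\<bar> \<Longrightarrow> cmod (\<phi> z) \<le> exp (- (c * \<bar>z\<bar> powr \<beta>))"
    using \<phi>_decay by blast
  \<comment> \<open>Chosen so that beta * N \<ge> n + 2: n powers pay for the moment and two for the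
    weight 1 + z^2.\<close>
  obtain N :: nat where N: "real (n + 2) / \<beta> < real N" using reals_Archimedean2 by blast
  then have N\<beta>: "real (n + 2) \<le> \<beta> * real N" using \<beta> by (simp add: field_simps)
  have "0 < real (n + 2) / \<beta>" using \<beta> by simp
  with N have N0: "0 < N" by (metis of_nat_0_less_iff less_trans)
  define C where "C = 2 + 2 * (real N / c) ^ N"
  have C2: "2 \<le> C" using c(1) by (simp add: C_def)
  have "\<bar>z\<bar> ^ n * cmod (\<phi> z) * (1 + z\<^sup>2) \<le> C" for z
  proof (cases "1 \<le> \<bar>z\<bar>")
    case False
    then have "z\<^sup>2 \<le> 1" by (simp add: abs_square_le_1)
    then have "\<bar>z\<bar> ^ n * cmod (\<phi> z) * (1 + z\<^sup>2) \<le> 1 * 1 * 2"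
      using False cmod_\<phi>_le_1 by (intro mult_mono power_le_one) auto
    with C2 show ?thesis by simp
  next
    case True
    then have z2: "1 + z\<^sup>2 \<le> 2 * \<bar>z\<bar> ^ 2" using one_le_power[of "\<bar>z\<bar>" 2] by simp
    have "cmod (\<phi> z) \<le> (real N / (c * \<bar>z\<bar> powr \<beta>)) ^ N"
      using c(2)[OF True] exp_minus_le_power[OF _ N0, of "c * \<bar>z\<bar> powr \<beta>"] c(1) True by (auto intro: order_trans)
    also have "\<dots> = (real N / c) ^ N / (\<bar>z\<bar> powr \<beta>) ^ N" by (simp add: power_divide power_mult_distrib)
    also have "(\<bar>z\<bar> powr \<beta>) ^ N = \<bar>z\<bar> powr (\<beta> * real N)"
      using True by (simp add: powr_powr flip: powr_realpow)
    finally have 1: "cmod (\<phi> z) \<le> (real N / c) ^ N / \<bar>z\<bar> powr (\<beta> * real N)" .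
    have "\<bar>z\<bar> powr real (n + 2) \<le> \<bar>z\<bar> powr (\<beta> * real N)" using True N\<beta> by (intro powr_mono) auto
    then have "\<bar>z\<bar> ^ (n + 2) \<le> \<bar>z\<bar> powr (\<beta> * real N)" using True by (subst (asm) powr_realpow) auto
    then have "(real N / c) ^ N / \<bar>z\<bar> powr (\<beta> * real N) \<le> (real N / c) ^ N / \<bar>z\<bar> ^ (n + 2)"
      using c(1) True by (intro divide_left_mono) auto
    with 1 have "cmod (\<phi> z) \<le> (real N / c) ^ N / \<bar>z\<bar> ^ (n + 2)" by linarith
    then have "\<bar>z\<bar> ^ n * cmod (\<phi> z) * (1 + z\<^sup>2) \<le> \<bar>z\<bar> ^ n * ((real N / c) ^ N / \<bar>z\<bar> ^ (n + 2)) * (2 * \<bar>z\<bar> ^ 2)"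
      using z2 c(1) by (intro mult_mono mult_left_mono) auto
    also have "\<dots> = 2 * (real N / c) ^ N"
    proof -
      have *: "a ^ n * (K / a ^ (n + 2)) * (2 * a ^ 2) = 2 * K" if "0 < a" for a K :: real
        using that by (simp add: power_add power2_eq_square)
      show ?thesis by (rule *) (use True in auto)
    qed
    finally show ?thesis by (simp add: C_def)
  qed
  moreover have "0 < 1 + z\<^sup>2" for z :: real by (simp add: add_pos_nonneg)
  ultimately show ?thesis
    by (intro exI[of _ C] allI) (simp add: divide_inverse[symmetric] pos_le_divide_eq)
qed

lemma \<phi>_moment_integrable: "integrable lborel (\<lambda>z. \<bar>z\<bar> ^ n * cmod (\<phi> z))"
proof -
  obtain C where C: "\<And>z. \<bar>z\<bar> ^ n * cmod (\<phi> z) \<le> C * inverse (1 + z\<^sup>2)" using \<phi>_rapid_decay by blast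
  show ?thesis
  proof (rule Bochner_Integration.integrable_bound)
    show "integrable lborel (\<lambda>z. C * inverse (1 + z\<^sup>2))"
      using integrable_inverse_1_plus_square_UNIV by simp
    show "AE z in lborel. norm (\<bar>z\<bar> ^ n * cmod (\<phi> z)) \<le> norm (C * inverse (1 + z\<^sup>2))"
      by (intro AE_I2) (use order_trans[OF C abs_ge_self] in \<open>simp add: abs_mult\<close>)
  qed measurable
qed

end

section \<open>Fourier inversion\<close>

lemma gaussian_fourier:
  assumes "0 < \<epsilon>"
  shows "(CLINT x|lborel. iexp (u * x) * of_real (exp (- (\<epsilon> * x)\<^sup>2 / 2)))
    = of_real (sqrt (2 * pi) / \<epsilon> * exp (- (u / \<epsilon>)\<^sup>2 / 2))"
proof -
  have std: "(CLINT s|lborel. iexp (v * s) * of_real (exp (- s\<^sup>2 / 2))) = of_real (sqrt (2 * pi) * exp (- v\<^sup>2 / 2))" for v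
  proof -
    have "complex_of_real (exp (- v\<^sup>2 / 2)) = char std_normal_distribution v"
      by (simp add: char_std_normal_distribution)
    also have "\<dots> = (CLINT s|lborel. std_normal_density s *\<^sub>R iexp (v * s))"
      unfolding char_def by (subst integral_density) (auto simp: normal_density_nonneg)
    also have "\<dots> = (CLINT s|lborel. of_real (1 / sqrt (2 * pi)) * (iexp (v * s) * of_real (exp (- s\<^sup>2 / 2))))"
      by (rule Bochner_Integration.integral_cong)
        (auto simp: std_normal_density_def scaleR_conv_of_real)
    also have "\<dots> = of_real (1 / sqrt (2 * pi)) * (CLINT s|lborel. iexp (v * s) * of_real (exp (- s\<^sup>2 / 2)))"
      by (rule integral_mult_right_zero)
    finally show ?thesis by (simp add: field_simps)
  qed
  have "(CLINT x|lborel. iexp (u * x) * of_real (exp (- (\<epsilon> * x)\<^sup>2 / 2)))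
     = \<bar>1 / \<epsilon>\<bar> *\<^sub>R (CLINT s|lborel. iexp (u * (0 + 1 / \<epsilon> * s)) * of_real (exp (- (\<epsilon> * (0 + 1 / \<epsilon> * s))\<^sup>2 / 2)))"
    using assms by (intro lborel_integral_real_affine) auto
  also have "\<dots> = \<bar>1 / \<epsilon>\<bar> *\<^sub>R (CLINT s|lborel. iexp (u / \<epsilon> * s) * of_real (exp (- s\<^sup>2 / 2)))"
    using assms by simp
  also have "\<dots> = of_real (sqrt (2 * pi) / \<epsilon> * exp (- (u / \<epsilon>)\<^sup>2 / 2))"
    using assms unfolding std by (simp add: scaleR_conv_of_real)
  finally show ?thesis .
qed

lemma gaussian_integrable:
  assumes "0 < \<epsilon>"
  shows "integrable lborel (\<lambda>x::real. exp (- (\<epsilon> * x)\<^sup>2 / 2))"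
proof -
  have "integrable lborel (\<lambda>x. sqrt (2 * pi) * std_normal_density (0 + \<epsilon> * x))"
    using assms by (intro integrable_mult_right lborel_integrable_real_affine integrable_normal_density) auto
  then show ?thesis by (simp add: std_normal_density_def)
qed

lemma integrable_pair_product:
  fixes a :: "real \<Rightarrow> complex" and b :: "real \<Rightarrow> complex" and h :: "real \<Rightarrow> real \<Rightarrow> complex"
  assumes "integrable lborel a" "integrable lborel b"
    and [measurable]: "case_prod h \<in> borel_measurable (lborel \<Otimes>\<^sub>M lborel)"
    and h: "\<And>x y. cmod (h x y) \<le> 1"
  shows "integrable (lborel \<Otimes>\<^sub>M lborel) (\<lambda>(x, y). a x * b y * h x y)"
proof -
  have [measurable]: "a \<in> borel_measurable borel" "b \<in> borel_measurable borel"
    using assms by (auto dest: borel_measurable_integrable)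
  have "integrable (lborel \<Otimes>\<^sub>M lborel) (\<lambda>(x, y). a x * b y)"
    by (rule lborel_pair.Fubini_integrable) (use assms in \<open>auto simp: norm_mult\<close>)
  then show ?thesis
  proof (rule Bochner_Integration.integrable_bound)
    show "AE z in lborel \<Otimes>\<^sub>M lborel. cmod (case z of (x, y) \<Rightarrow> a x * b y * h x y) \<le> cmod (case z of (x, y) \<Rightarrow> a x * b y)"
      using mult_left_mono[OF h] by (intro AE_I2) (auto simp: norm_mult split: prod.split)
  qed measurable
qed

context tempered
begin

text \<open>The inversion integral, differentiated n times under the integral sign; each
  differentiation contributes a factor - i z.\<close>

definition Fc :: "nat \<Rightarrow> real \<Rightarrow> complex" where
  "Fc n x = of_real (1 / (2 * pi)) * (CLINT z|lborel. (- \<i> * of_real z) ^ n * iexp (- x * z) * \<phi> z)"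

definition dens :: "nat \<Rightarrow> real \<Rightarrow> real" where "dens n x = Re (Fc n x)"

lemma Fc_integrable: "integrable lborel (\<lambda>z. (- \<i> * of_real z) ^ n * iexp (- x * z) * \<phi> z)"
  by (rule Bochner_Integration.integrable_bound[OF \<phi>_moment_integrable[of n]])
    (auto simp: norm_mult norm_power)

lemma \<phi>_integrable: "integrable lborel \<phi>"
  using Fc_integrable[of 0 0] by simp

lemma Fc_deriv: "(Fc n has_vector_derivative Fc (Suc n) x) (at x)"
proof -
  have "((\<lambda>x. CLINT z|lborel. (- \<i> * of_real z) ^ n * iexp (- x * z) * \<phi> z) has_vector_derivative
      (CLINT z|lborel. (- \<i> * of_real z) ^ Suc n * iexp (- x * z) * \<phi> z)) (at x)"
  proof (rule has_vector_derivative_lebesgue_integral[OF Fc_integrable _ _ \<phi>_moment_integrable[of "Suc n"]])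
    show "((\<lambda>x. (- \<i> * of_real z) ^ n * iexp (- x * z) * \<phi> z) has_vector_derivative
        (- \<i> * of_real z) ^ Suc n * iexp (- x * z) * \<phi> z) (at x)" for x z
    proof -
      have "((\<lambda>x. (- \<i> * of_real z) ^ n * iexp (- x * z) * \<phi> z) has_vector_derivative
        (- \<i> * of_real z) ^ n * ((- z) *\<^sub>R (\<i> * iexp (- x * z))) * \<phi> z) (at x)"
        by (intro has_vector_derivative_mult_left has_vector_derivative_mult_right
            vector_diff_chain_at[where f="\<lambda>x. - x * z" and g=iexp, unfolded o_def] has_vector_derivative_iexp)
          (auto intro!: derivative_eq_intros simp: has_real_derivative_iff_has_vector_derivative[symmetric])
      then show ?thesis by (simp add: scaleR_conv_of_real mult_ac)
    qed
    show "(\<lambda>z. (- \<i> * of_real z) ^ Suc n * iexp (- x * z) * \<phi> z) \<in> borel_measurable lborel" for x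
      using Fc_integrable by (rule borel_measurable_integrable)
    show "cmod ((- \<i> * of_real z) ^ Suc n * iexp (- x * z) * \<phi> z) \<le> \<bar>z\<bar> ^ Suc n * cmod (\<phi> z)" for x z
      by (simp add: norm_mult norm_power)
  qed
  then show ?thesis unfolding Fc_def[abs_def] by (rule has_vector_derivative_mult_right)
qed

lemma dens_deriv: "(dens n has_real_derivative dens (Suc n) x) (at x)"
  unfolding has_real_derivative_iff_has_vector_derivative dens_def[abs_def]
  using bounded_linear.has_vector_derivative[OF bounded_linear_Re Fc_deriv] by simp

lemma dens_cont: "continuous_on S (dens n)"
  by (rule continuous_on_subset[OF _ subset_UNIV])
    (auto intro!: continuous_at_imp_continuous_on DERIV_isCont[OF dens_deriv])

lemma dens_bounded: "\<exists>B. \<forall>x. \<bar>dens n x\<bar> \<le> B"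
proof -
  let ?I = "LINT z|lborel. \<bar>z\<bar> ^ n * cmod (\<phi> z)"
  have "\<bar>dens n x\<bar> \<le> 1 / (2 * pi) * ?I" for x
  proof -
    have "\<bar>dens n x\<bar> \<le> cmod (Fc n x)" unfolding dens_def by (rule abs_Re_le_cmod)
    also have "\<dots> = 1 / (2 * pi) * cmod (CLINT z|lborel. (- \<i> * of_real z) ^ n * iexp (- x * z) * \<phi> z)"
      by (simp add: Fc_def norm_mult norm_divide)
    also have "\<dots> \<le> 1 / (2 * pi) * ?I"
      by (intro mult_left_mono integral_norm_bound[THEN order_trans]) (auto simp: norm_mult norm_power)
    finally show ?thesis .
  qed
  then show ?thesis by blast
qed

text \<open>Conjugating the characteristic function reflects its argument, and reflecting the
  integration variable undoes this.\<close>

lemma Fc_0: "Fc 0 x = of_real (dens 0 x)"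
proof -
  have "cnj (CLINT z|lborel. iexp (- x * z) * \<phi> z) = (CLINT z|lborel. cnj (iexp (- x * z) * \<phi> z))"
    by (rule Bochner_Integration.integral_cnj[symmetric])
  also have "\<dots> = (CLINT z|lborel. iexp (- x * (- z)) * \<phi> (- z))"
    by (rule Bochner_Integration.integral_cong) (auto simp: exp_cnj \<phi>_cnj)
  also have "\<dots> = (CLINT z|lborel. iexp (- x * z) * \<phi> z)"
    using lborel_integral_real_affine[of "-1" "\<lambda>z. iexp (- x * z) * \<phi> z" 0] by simp
  finally have "cnj (Fc 0 x) = Fc 0 x" by (simp add: Fc_def)
  then show ?thesis unfolding dens_def by (metis Reals_cnj_iff of_real_Re)
qed

text \<open>The derivative of G z = exp (- i x z) \<open>\<phi>\<close> z integrates to 0 over the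
  line, because G vanishes at both ends. Written out with \<open>\<phi>_deriv\<close>, this equates
  x times the inversion integral with the inversion integral of khat times
  \<open>\<phi>\<close>.\<close>

lemma dens_eq: "x * dens 0 x = (LINT y|lborel. dens 0 (x - y) * k y)"
proof -
  define I where "I x = (CLINT z|lborel. iexp (- x * z) * \<phi> z)" for x
  have I: "I x = of_real (2 * pi * dens 0 x)" for x
    using Fc_0[of x] by (simp add: Fc_def I_def field_simps)
  define G where "G z = iexp (- x * z) * \<phi> z" for z
  define G' where "G' z = \<i> * (iexp (- x * z) * (khat z * \<phi> z)) - \<i> * of_real x * G z" for z
  have G_int: "integrable lborel G" unfolding G_def using Fc_integrable[of 0 x] by simp
  have H_int: "integrable lborel (\<lambda>z. iexp (- x * z) * (khat z * \<phi> z))"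
  proof (rule Bochner_Integration.integrable_bound[where f="\<lambda>z. (LINT y|lborel. k y) * cmod (\<phi> z)"])
    show "integrable lborel (\<lambda>z. (LINT y|lborel. k y) * cmod (\<phi> z))" using \<phi>_integrable by simp
    have [measurable]: "khat \<in> borel_measurable borel" by (rule borel_measurable_continuous_onI[OF khat_cont])
    show "(\<lambda>z. iexp (- x * z) * (khat z * \<phi> z)) \<in> borel_measurable lborel" by measurable
    show "AE z in lborel. cmod (iexp (- x * z) * (khat z * \<phi> z)) \<le> norm ((LINT y|lborel. k y) * cmod (\<phi> z))"
      using cmod_khat by (intro AE_I2) (auto simp: norm_mult abs_mult intro!: mult_right_mono order_trans[OF cmod_khat abs_ge_self])
  qed
  have lim: "(G \<longlongrightarrow> 0) F" if "((\<lambda>z. inverse (1 + z\<^sup>2)) \<longlongrightarrow> 0) F" for F :: "real filter"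
  proof -
    obtain C where C: "\<And>z. \<bar>z\<bar> ^ 0 * cmod (\<phi> z) \<le> C * inverse (1 + z\<^sup>2)" using \<phi>_rapid_decay by blast
    show ?thesis
    proof (rule Lim_null_comparison)
      show "\<forall>\<^sub>F z in F. norm (G z) \<le> C * inverse (1 + z\<^sup>2)"
        using C by (intro always_eventually) (simp add: G_def norm_mult)
      show "((\<lambda>z. C * inverse (1 + z\<^sup>2)) \<longlongrightarrow> 0) F" using tendsto_mult_left[OF that, of C] by simp
    qed
  qed
  have "integral\<^sup>L lborel G' = 0"
  proof (rule integral_derivative_vanishing)
    show "(G has_vector_derivative G' z) (at z)" for z
    proof -
      have "((\<lambda>z. iexp (- x * z)) has_vector_derivative (- x) *\<^sub>R (\<i> * iexp (- x * z))) (at z)"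
        by (intro vector_diff_chain_at[where f="\<lambda>z. - x * z" and g=iexp, unfolded o_def] has_vector_derivative_iexp)
          (auto intro!: derivative_eq_intros simp: has_real_derivative_iff_has_vector_derivative[symmetric])
      from has_vector_derivative_mult[OF this \<phi>_deriv] show ?thesis
        by (simp add: G_def[abs_def] G'_def scaleR_conv_of_real algebra_simps)
    qed
    have "continuous_on UNIV G'"
      unfolding G'_def G_def by (intro continuous_intros khat_cont \<phi>_cont)
    then show "isCont G' z" for z by (simp add: continuous_on_eq_continuous_at)
    show "integrable lborel G'" unfolding G'_def using H_int G_int by auto
    show "(G \<longlongrightarrow> 0) at_top" "(G \<longlongrightarrow> 0) at_bot" by (intro lim; real_asymp)+
  qed
  also have "integral\<^sup>L lborel G' = \<i> * (CLINT z|lborel. iexp (- x * z) * (khat z * \<phi> z)) - \<i> * of_real x * I x"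
  proof -
    have "I x = integral\<^sup>L lborel G" unfolding I_def G_def ..
    then show ?thesis unfolding G'_def using H_int G_int by simp
  qed
  finally have "of_real x * I x = (CLINT z|lborel. iexp (- x * z) * (khat z * \<phi> z))" by (simp add: algebra_simps)
  \<comment> \<open>Unfolding khat and exchanging the integrals turns multiplication by khat into
    convolution with k.\<close>
  also have "\<dots> = (CLINT z|lborel. CLINT y|lborel. \<phi> z * of_real (k y) * iexp (- (x - y) * z))"
  proof (rule Bochner_Integration.integral_cong[OF refl])
    fix z
    have "iexp (- x * z) * (khat z * \<phi> z) = (CLINT y|lborel. iexp (- x * z) * \<phi> z * (iexp (z * y) * of_real (k y)))"
      unfolding khat_def by (subst integral_mult_right_zero) (simp add: mult_ac)
    also have "\<dots> = (CLINT y|lborel. \<phi> z * of_real (k y) * iexp (- (x - y) * z))"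
      by (rule Bochner_Integration.integral_cong) (auto simp: algebra_simps simp flip: exp_add)
    finally show "iexp (- x * z) * (khat z * \<phi> z) = (CLINT y|lborel. \<phi> z * of_real (k y) * iexp (- (x - y) * z))" .
  qed
  also have "\<dots> = (CLINT y|lborel. CLINT z|lborel. \<phi> z * of_real (k y) * iexp (- (x - y) * z))"
    using integrable_pair_product[OF \<phi>_integrable, of "\<lambda>y. of_real (k y)" "\<lambda>z y. iexp (- (x - y) * z)"] k_integrable
    by (intro lborel_pair.Fubini_integral[symmetric]) auto
  also have "\<dots> = (CLINT y|lborel. of_real (2 * pi * (dens 0 (x - y) * k y)))"
  proof (rule Bochner_Integration.integral_cong[OF refl])
    fix y
    have "(CLINT z|lborel. \<phi> z * of_real (k y) * iexp (- (x - y) * z)) = (CLINT z|lborel. of_real (k y) * (iexp (- (x - y) * z) * \<phi> z))"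
      by (simp add: mult_ac)
    also have "\<dots> = of_real (k y) * I (x - y)"
      unfolding I_def by (rule integral_mult_right_zero)
    finally show "(CLINT z|lborel. \<phi> z * of_real (k y) * iexp (- (x - y) * z)) = of_real (2 * pi * (dens 0 (x - y) * k y))"
      by (simp add: I mult_ac)
  qed
  also have "\<dots> = of_real (2 * pi * (LINT y|lborel. dens 0 (x - y) * k y))"
    by (simp only: integral_complex_of_real integral_mult_right_zero)
  finally have "complex_of_real (x * (2 * pi * dens 0 x)) = of_real (2 * pi * (LINT y|lborel. dens 0 (x - y) * k y))"
    by (simp add: I)
  then have "x * (2 * pi * dens 0 x) = 2 * pi * (LINT y|lborel. dens 0 (x - y) * k y)"
    by (simp only: of_real_eq_iff)
  then show ?thesis by simp
qed

lemma dens_volterra: "\<exists>B. volterra k k' (dens 0) (dens 1) B"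
proof -
  obtain B0 B1 where B: "\<And>x. \<bar>dens 0 x\<bar> \<le> B0" "\<And>x. \<bar>dens 1 x\<bar> \<le> B1" using dens_bounded by meson
  interpret K: decreasing_kernel k k' by (rule kernel)
  have "volterra k k' (dens 0) (dens 1) (max B0 B1)"
    by unfold_locales
      (use dens_deriv[of 0] B dens_cont dens_eq in \<open>auto simp: le_max_iff_disj\<close>)
  then show ?thesis by blast
qed

end

section \<open>Uniqueness and smoothness of densities; Gaussian damping\<close>

text \<open>The set where two continuous densities differ is open and null, hence empty.\<close>

lemma continuous_density_unique:
  assumes g: "is_density_of g M" "continuous_on UNIV g" and h: "is_density_of h M" "continuous_on UNIV h"
  shows "g = h"
proof (rule ccontr)
  assume "g \<noteq> h"
  have [measurable]: "g \<in> borel_measurable borel" "h \<in> borel_measurable borel"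
    and nn: "\<And>x. 0 \<le> g x" "\<And>x. 0 \<le> h x"
    and eq: "density lborel (\<lambda>x. ennreal (g x)) = density lborel (\<lambda>x. ennreal (h x))"
    using g h by (auto simp: is_density_of_def)
  have "AE x in lborel. ennreal (g x) = ennreal (h x)"
    using eq by (subst (asm) sigma_finite_measure.density_unique_iff[OF lborel.sigma_finite_measure_axioms]) auto
  then have ae: "AE x in lborel. x \<notin> {x. g x \<noteq> h x}"
    by (rule AE_mp) (use nn in \<open>auto simp: ennreal_inj\<close>)
  have op: "open {x. g x \<noteq> h x}" using g h by (intro open_Collect_neq) auto
  then have "{x. g x \<noteq> h x} \<in> null_sets lborel"
    using ae by (subst AE_iff_null_sets) auto
  then have "negligible {x. g x \<noteq> h x}"
    by (simp add: negligible_iff_null_sets null_sets_completionI)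
  then have "{x. g x \<noteq> h x} = {}" using open_not_negligible[OF op] by blast
  then show False using \<open>g \<noteq> h\<close> by auto
qed

lemma smooth_of_derivatives:
  assumes "\<And>n x. (d n has_real_derivative d (Suc n) x) (at x)"
  shows "smooth (d 0)" "(deriv ^^ n) (d 0) = d n"
proof -
  show iter: "(deriv ^^ n) (d 0) = d n" for n
  proof (induction n)
    case (Suc n)
    have "deriv (d n) = d (Suc n)" using assms by (intro ext DERIV_imp_deriv)
    then show ?case using Suc by simp
  qed simp
  show "smooth (d 0)" unfolding smooth_def iter
    using assms real_differentiable_def by blast
qed

lemma smooth_continuous:
  assumes "smooth g"
  shows "continuous_on UNIV g"
  using assms[unfolded smooth_def, rule_format, of 0]
  by (auto intro!: continuous_at_imp_continuous_on differentiable_imp_continuous_within)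

definition gauss :: "nat \<Rightarrow> real \<Rightarrow> real" where "gauss n x = exp (- (inverse (real (Suc n)) * x)\<^sup>2 / 2)"

lemma gauss_pos: "0 < gauss n x" and gauss_le_1: "gauss n x \<le> 1"
  by (auto simp: gauss_def)

text \<open>Integrability of \<open>dens 0\<close> is still unknown, so its transform is taken with
  a Gaussian factor. That the factors increase to 1 lets monotone convergence remove them
  later.\<close>

lemma gauss_mono: "mono (\<lambda>n. gauss n x)"
proof (rule monoI)
  fix m n :: nat assume "m \<le> n"
  then have "inverse (real (Suc n)) * \<bar>x\<bar> \<le> inverse (real (Suc m)) * \<bar>x\<bar>"
    by (intro mult_right_mono le_imp_inverse_le) auto
  then have "\<bar>inverse (real (Suc n)) * x\<bar> \<le> \<bar>inverse (real (Suc m)) * x\<bar>" by (simp add: abs_mult)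
  then show "gauss m x \<le> gauss n x" by (simp add: gauss_def abs_le_square_iff del: of_nat_Suc)
qed

lemma gauss_limit: "(\<lambda>n. gauss n x) \<longlonglongrightarrow> 1"
proof -
  have "(\<lambda>n. exp (- (inverse (real (Suc n)) * x)\<^sup>2 / 2)) \<longlonglongrightarrow> exp (- (0 * x)\<^sup>2 / 2)"
    by (intro tendsto_intros LIMSEQ_inverse_real_of_nat) auto
  then show ?thesis by (simp add: gauss_def)
qed

lemma gauss_meas [measurable]: "gauss n \<in> borel_measurable borel"
  unfolding gauss_def[abs_def] by measurable

context tempered
begin

text \<open>The damping justifies Fubini. The inner integral over x is then a Gaussian transform, so
  what remains is an average of \<open>\<phi>\<close> against a normal law centred at t with
  standard deviation \<open>\<epsilon>\<close>.\<close>

lemma gaussian_smoothing: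
  assumes \<epsilon>: "0 < \<epsilon>"
  shows "(CLINT x|lborel. Fc 0 x * iexp (t * x) * of_real (exp (- (\<epsilon> * x)\<^sup>2 / 2)))
    = (CLINT s|lborel. std_normal_density s *\<^sub>R \<phi> (t + \<epsilon> * s))"
proof -
  let ?e = "\<lambda>x. complex_of_real (exp (- (\<epsilon> * x)\<^sup>2 / 2))"
  let ?c = "complex_of_real (1 / (2 * pi))"
  have "(CLINT x|lborel. Fc 0 x * iexp (t * x) * ?e x)
      = (CLINT x|lborel. ?c * (CLINT z|lborel. \<phi> z * ?e x * iexp ((t - z) * x)))"
  proof (rule Bochner_Integration.integral_cong[OF refl])
    fix x
    have "(CLINT z|lborel. \<phi> z * ?e x * iexp ((t - z) * x)) = (CLINT z|lborel. iexp (- x * z) * \<phi> z * (iexp (t * x) * ?e x))"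
      by (rule Bochner_Integration.integral_cong) (auto simp: algebra_simps simp flip: exp_add)
    also have "\<dots> = (CLINT z|lborel. iexp (- x * z) * \<phi> z) * (iexp (t * x) * ?e x)"
      by (rule integral_mult_left_zero)
    finally show "Fc 0 x * iexp (t * x) * ?e x = ?c * (CLINT z|lborel. \<phi> z * ?e x * iexp ((t - z) * x))"
      by (simp add: Fc_def mult_ac)
  qed
  also have "\<dots> = ?c * (CLINT x|lborel. CLINT z|lborel. \<phi> z * ?e x * iexp ((t - z) * x))"
    by (rule integral_mult_right_zero)
  also have "(CLINT x|lborel. CLINT z|lborel. \<phi> z * ?e x * iexp ((t - z) * x))
      = (CLINT z|lborel. CLINT x|lborel. \<phi> z * ?e x * iexp ((t - z) * x))"
    using integrable_pair_product[OF \<phi>_integrable, of ?e "\<lambda>z x. iexp ((t - z) * x)"] gaussian_integrable[OF \<epsilon>]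
    by (intro lborel_pair.Fubini_integral) auto
  also have "\<dots> = (CLINT z|lborel. \<phi> z * of_real (sqrt (2 * pi) / \<epsilon> * exp (- ((t - z) / \<epsilon>)\<^sup>2 / 2)))"
  proof (rule Bochner_Integration.integral_cong[OF refl])
    fix z
    have "(CLINT x|lborel. \<phi> z * ?e x * iexp ((t - z) * x)) = (CLINT x|lborel. \<phi> z * (iexp ((t - z) * x) * ?e x))"
      by (rule Bochner_Integration.integral_cong) (auto simp: mult_ac)
    also have "\<dots> = \<phi> z * (CLINT x|lborel. iexp ((t - z) * x) * ?e x)"
      by (rule integral_mult_right_zero)
    finally show "(CLINT x|lborel. \<phi> z * ?e x * iexp ((t - z) * x))
        = \<phi> z * of_real (sqrt (2 * pi) / \<epsilon> * exp (- ((t - z) / \<epsilon>)\<^sup>2 / 2))"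
      by (simp only: gaussian_fourier[OF \<epsilon>])
  qed
  also have "\<dots> = \<bar>\<epsilon>\<bar> *\<^sub>R (CLINT s|lborel. \<phi> (t + \<epsilon> * s) * of_real (sqrt (2 * pi) / \<epsilon> * exp (- ((t - (t + \<epsilon> * s)) / \<epsilon>)\<^sup>2 / 2)))"
    using \<epsilon> by (intro lborel_integral_real_affine) auto
  also have "\<dots> = (CLINT s|lborel. of_real (2 * pi) * (std_normal_density s *\<^sub>R \<phi> (t + \<epsilon> * s)))"
    unfolding integral_scaleR_right[symmetric]
  proof (rule Bochner_Integration.integral_cong[OF refl])
    fix s
    have "((t - (t + \<epsilon> * s)) / \<epsilon>)\<^sup>2 = s\<^sup>2" using \<epsilon> by simp
    moreover have "complex_of_real (sqrt (2 * pi)) * complex_of_real (sqrt (2 * pi)) = of_real (2 * pi)"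
      by (simp flip: of_real_mult)
    ultimately show "\<bar>\<epsilon>\<bar> *\<^sub>R (\<phi> (t + \<epsilon> * s) * of_real (sqrt (2 * pi) / \<epsilon> * exp (- ((t - (t + \<epsilon> * s)) / \<epsilon>)\<^sup>2 / 2)))
        = of_real (2 * pi) * (std_normal_density s *\<^sub>R \<phi> (t + \<epsilon> * s))"
      using \<epsilon> by (simp add: std_normal_density_def scaleR_conv_of_real field_simps)
  qed
  also have "\<dots> = of_real (2 * pi) * (CLINT s|lborel. std_normal_density s *\<^sub>R \<phi> (t + \<epsilon> * s))"
    by (rule integral_mult_right_zero)
  finally show ?thesis by simp
qed

lemma dens_meas [measurable]: "dens n \<in> borel_measurable borel"
  by (rule borel_measurable_continuous_onI[OF dens_cont])

lemma dens_gauss_integrable: "integrable lborel (\<lambda>x. dens 0 x * gauss n x)"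
proof -
  obtain B where B: "\<And>x. \<bar>dens 0 x\<bar> \<le> B" using dens_bounded by blast
  have "integrable lborel (gauss n)" unfolding gauss_def by (rule gaussian_integrable) simp
  then show ?thesis
    using B by (intro Bochner_Integration.integrable_bound[where f="\<lambda>x. B * gauss n x" and g="\<lambda>x. dens 0 x * gauss n x"])
      (auto simp: abs_mult gauss_pos less_imp_le intro!: mult_right_mono order_trans[OF B abs_ge_self])
qed

text \<open>The averages of the continuous function \<open>\<phi>\<close> concentrate at t, with
  domination from \<bar>\<phi>\<bar> \<le> 1.\<close>

lemma gaussian_inversion:
  "(\<lambda>n. CLINT x|lborel. of_real (dens 0 x * gauss n x) * iexp (t * x)) \<longlonglongrightarrow> \<phi> t"
proof -
  have "(\<lambda>n. CLINT s|lborel. std_normal_density s *\<^sub>R \<phi> (t + inverse (real (Suc n)) * s))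
      \<longlonglongrightarrow> (CLINT s|lborel. std_normal_density s *\<^sub>R \<phi> t)"
  proof (rule integral_dominated_convergence[where w=std_normal_density])
    show "AE s in lborel. (\<lambda>n. std_normal_density s *\<^sub>R \<phi> (t + inverse (real (Suc n)) * s)) \<longlonglongrightarrow> std_normal_density s *\<^sub>R \<phi> t"
    proof (intro AE_I2 tendsto_scaleR tendsto_const)
      fix s
      have "(\<lambda>n. t + inverse (real (Suc n)) * s) \<longlonglongrightarrow> t + 0 * s"
        by (intro tendsto_intros LIMSEQ_inverse_real_of_nat)
      then show "(\<lambda>n. \<phi> (t + inverse (real (Suc n)) * s)) \<longlonglongrightarrow> \<phi> t"
        using \<phi>_cont[of UNIV] by (intro continuous_on_tendsto_compose[OF \<phi>_cont[of UNIV]]) auto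
    qed
    show "AE s in lborel. cmod (std_normal_density s *\<^sub>R \<phi> (t + inverse (real (Suc n)) * s)) \<le> std_normal_density s" for n
      using cmod_\<phi>_le_1 by (intro AE_I2) (simp add: mult_left_le)
  qed auto
  also have "(CLINT s|lborel. std_normal_density s *\<^sub>R \<phi> t) = \<phi> t"
    by (subst integral_scaleR_left) auto
  also have "(\<lambda>n. CLINT s|lborel. std_normal_density s *\<^sub>R \<phi> (t + inverse (real (Suc n)) * s))
      = (\<lambda>n. CLINT x|lborel. of_real (dens 0 x * gauss n x) * iexp (t * x))"
  proof
    fix n
    show "(CLINT s|lborel. std_normal_density s *\<^sub>R \<phi> (t + inverse (real (Suc n)) * s))
       = (CLINT x|lborel. of_real (dens 0 x * gauss n x) * iexp (t * x))"
      by (subst gaussian_smoothing[symmetric]) (auto simp: Fc_0 gauss_def mult_ac)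
  qed
  finally show ?thesis .
qed

text \<open>The case t = 0. It acts as a total mass before integrability is known: it excludes the
  zero and the negative solution, and afterwards yields mass 1.\<close>

lemma dens_gauss_limit: "(\<lambda>n. LINT x|lborel. dens 0 x * gauss n x) \<longlonglongrightarrow> 1"
proof -
  have "(\<lambda>n. complex_of_real (LINT x|lborel. dens 0 x * gauss n x)) \<longlonglongrightarrow> of_real 1"
    using gaussian_inversion[of 0] by (simp add: \<phi>_0 integral_complex_of_real del: of_real_mult)
  then show ?thesis by (simp only: tendsto_of_real_iff)
qed

lemma dens_nonzero: "\<exists>x. dens 0 x \<noteq> 0"
proof (rule ccontr)
  assume "\<not> ?thesis"
  then have "(\<lambda>n. LINT x|lborel. dens 0 x * gauss n x) = (\<lambda>n. 0)" by simp
  with dens_gauss_limit show False using LIMSEQ_unique[OF tendsto_const] by fastforce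
qed

lemma dens_zero: "x \<le> 0 \<Longrightarrow> dens 0 x = 0"
proof -
  obtain B x0 where "volterra k k' (dens 0) (dens 1) B" "dens 0 x0 \<noteq> 0"
    using dens_volterra dens_nonzero by blast
  then show "x \<le> 0 \<Longrightarrow> dens 0 x = 0" by (rule volterra.support(1))
qed

text \<open>\<open>one_sign\<close> leaves two possibilities, and the total mass 1 excludes the negative one.\<close>

lemma dens_pos: "0 < x \<Longrightarrow> 0 < dens 0 x"
proof -
  obtain B x0 where *: "volterra k k' (dens 0) (dens 1) B" "dens 0 x0 \<noteq> 0"
    using dens_volterra dens_nonzero by blast
  have "\<not> (\<forall>x>0. dens 0 x < 0)"
  proof
    assume neg: "\<forall>x>0. dens 0 x < 0"
    have "dens 0 x \<le> 0" for x using neg dens_zero[of x] by (cases "x \<le> 0") (auto intro: less_imp_le)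
    then have "0 \<le> (LINT x|lborel. - (dens 0 x * gauss n x))" for n
      using gauss_pos[of n] by (intro Bochner_Integration.integral_nonneg) (simp add: mult_nonpos_nonneg less_imp_le)
    then have "(LINT x|lborel. dens 0 x * gauss n x) \<le> 0" for n by simp
    with dens_gauss_limit have "(1::real) \<le> 0" by (intro LIMSEQ_le_const2) auto
    then show False by simp
  qed
  then show "0 < x \<Longrightarrow> 0 < dens 0 x" using volterra.one_sign[OF *] by blast
qed

lemma dens_nonneg: "0 \<le> dens 0 x"
  using dens_zero[of x] dens_pos[of x] by (cases "x \<le> 0") auto

lemma dens_integrable: "integrable lborel (dens 0)" and dens_integral: "(LINT x|lborel. dens 0 x) = 1"
proof -
  have "AE x in lborel. mono (\<lambda>n. dens 0 x * gauss n x)"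
    using gauss_mono by (intro AE_I2) (auto simp: mono_def dens_nonneg intro!: mult_left_mono)
  moreover have "AE x in lborel. (\<lambda>n. dens 0 x * gauss n x) \<longlonglongrightarrow> dens 0 x"
    using tendsto_mult_left[OF gauss_limit] by (intro AE_I2) fastforce
  moreover have "dens 0 \<in> borel_measurable lborel" by simp
  ultimately show "integrable lborel (dens 0)" "(LINT x|lborel. dens 0 x) = 1"
    using integrable_monotone_convergence[OF dens_gauss_integrable _ _ dens_gauss_limit]
      integral_monotone_convergence[OF dens_gauss_integrable _ _ dens_gauss_limit] by blast+
qed

lemma dens_fourier: "(CLINT x|lborel. of_real (dens 0 x) * iexp (t * x)) = \<phi> t"
proof (rule LIMSEQ_unique[OF _ gaussian_inversion])
  show "(\<lambda>n. CLINT x|lborel. of_real (dens 0 x * gauss n x) * iexp (t * x))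
     \<longlonglongrightarrow> (CLINT x|lborel. of_real (dens 0 x) * iexp (t * x))"
  proof (rule integral_dominated_convergence[where w="dens 0"])
    show "AE x in lborel. (\<lambda>n. of_real (dens 0 x * gauss n x) * iexp (t * x)) \<longlonglongrightarrow> of_real (dens 0 x) * iexp (t * x)"
    proof (intro AE_I2 tendsto_mult tendsto_const tendsto_of_real)
      show "(\<lambda>n. dens 0 x * gauss n x) \<longlonglongrightarrow> dens 0 x" for x
        using tendsto_mult_left[OF gauss_limit, of "dens 0 x"] by simp
    qed
    show "AE x in lborel. cmod (of_real (dens 0 x * gauss n x) * iexp (t * x)) \<le> dens 0 x" for n
      using gauss_pos[of n] gauss_le_1[of n] by (intro AE_I2) (simp add: norm_mult dens_nonneg less_imp_le mult_left_le)
  qed (use dens_integrable in auto)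
qed

lemma dens_real_distribution: "real_distribution (density lborel (dens 0))"
proof -
  have "prob_space (density lborel (dens 0))"
  proof (rule prob_spaceI)
    have "emeasure (density lborel (dens 0)) UNIV = (\<integral>\<^sup>+x. ennreal (dens 0 x) \<partial>lborel)"
      by (simp add: emeasure_density)
    also have "\<dots> = 1"
      using dens_integrable dens_nonneg by (subst nn_integral_eq_integral) (auto simp: dens_integral)
    finally show "emeasure (density lborel (dens 0)) (space (density lborel (dens 0))) = 1" by simp
  qed
  then show ?thesis by (auto simp: real_distribution_def real_distribution_axioms_def)
qed

lemma char_dens: "char (density lborel (dens 0)) t = \<phi> t"
  unfolding char_def
  by (subst integral_density) (use dens_fourier[of t] in \<open>auto simp: dens_nonneg scaleR_conv_of_real\<close>)

lemma \<phi>_eq_exp_levy: "\<phi> z = exp (CLINT x|ts_levy_measure \<alpha> \<beta> l. iexp (z * x) - 1)"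
proof -
  have "ts_levy_measure \<alpha> \<beta> l = density lborel (\<lambda>x. ennreal (w x))"
    by (simp add: ts_levy_measure_def ts_weight_def)
  then have "(CLINT x|ts_levy_measure \<alpha> \<beta> l. iexp (z * x) - 1) = \<psi> z"
    unfolding \<psi>_def by (simp, subst integral_density) (auto simp: w_nonneg scaleR_conv_of_real mult.commute)
  then show ?thesis by (simp add: \<phi>_def)
qed

text \<open>The inverted density witnesses existence for the definite description, and the
  uniqueness theorem for characteristic functions does the rest.\<close>

theorem TS_one_eq: "TS_one \<alpha> \<beta> l = density lborel (dens 0)"
  unfolding TS_one_def
proof (rule the_equality)
  show "real_distribution (density lborel (dens 0)) \<and> (\<forall>z. char (density lborel (dens 0)) z
      = exp (CLINT x|ts_levy_measure \<alpha> \<beta> l. iexp (z * x) - 1))"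
    by (simp add: dens_real_distribution char_dens \<phi>_eq_exp_levy)
  fix M assume "real_distribution M \<and> (\<forall>z. char M z = exp (CLINT x|ts_levy_measure \<alpha> \<beta> l. iexp (z * x) - 1))"
  then show "M = density lborel (dens 0)"
    by (intro Levy_uniqueness dens_real_distribution) (auto simp: char_dens \<phi>_eq_exp_levy)
qed

lemma TS_one_is_density: "is_density_of (dens 0) (TS_one \<alpha> \<beta> l)"
  by (simp add: is_density_of_def dens_nonneg TS_one_eq)

lemma dens_tempered_volterra: "\<exists>B. tempered_volterra \<alpha> \<beta> l (dens 0) (dens 1) B"
proof -
  obtain B where "volterra k k' (dens 0) (dens 1) B" using dens_volterra by blast
  then have "tempered_volterra \<alpha> \<beta> l (dens 0) (dens 1) B"
    by (intro tempered_volterra.intro positive_volterra.intro positive_volterra_axioms.intro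
        tempered_axioms dens_zero dens_pos)
  then show ?thesis ..
qed

lemma dens_tilted_unimodal:
  "0 \<le> c \<Longrightarrow> \<exists>m>0. (\<forall>x. 0 < x \<and> x < m \<longrightarrow> c * dens 0 x < dens 1 x) \<and> dens 1 m = c * dens 0 m
     \<and> (\<forall>x>m. dens 1 x < c * dens 0 x)"
  using dens_tempered_volterra tempered_volterra.tilted_unimodal by blast

text \<open>The tilt c = 0 is the plain sign change of the derivative. Any competing smooth density
  equals \<open>dens 0\<close>, whose derivative has only one zero on the positive
  half-line.\<close>

lemma mode_TS_one:
  shows "0 < mode (TS_one \<alpha> \<beta> l)"
    and "\<And>x. 0 < x \<Longrightarrow> x < mode (TS_one \<alpha> \<beta> l) \<Longrightarrow> 0 < dens 1 x"
    and "dens 1 (mode (TS_one \<alpha> \<beta> l)) = 0"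
    and "\<And>x. mode (TS_one \<alpha> \<beta> l) < x \<Longrightarrow> dens 1 x < 0"
proof -
  obtain m where m: "0 < m" "\<And>x. 0 < x \<Longrightarrow> x < m \<Longrightarrow> 0 < dens 1 x" "dens 1 m = 0" "\<And>x. m < x \<Longrightarrow> dens 1 x < 0"
    using dens_tilted_unimodal[of 0] by auto
  have d1: "deriv (dens 0) = dens 1" using smooth_of_derivatives(2)[where d=dens, OF dens_deriv, of 1] by simp
  have "mode (TS_one \<alpha> \<beta> l) = m"
    unfolding mode_def
  proof (rule the_equality)
    show "0 < m \<and> (\<exists>g. is_density_of g (TS_one \<alpha> \<beta> l) \<and> smooth g \<and> (\<forall>x\<in>{0<..<m}. deriv g x > 0) \<and>
             deriv g m = 0 \<and> (\<forall>x\<in>{m<..}. deriv g x < 0))"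
      using m TS_one_is_density smooth_of_derivatives(1)[where d=dens, OF dens_deriv] by (auto intro!: exI[of _ "dens 0"] simp: d1)
    fix m' assume m': "0 < m' \<and> (\<exists>g. is_density_of g (TS_one \<alpha> \<beta> l) \<and> smooth g \<and> (\<forall>x\<in>{0<..<m'}. deriv g x > 0) \<and>
             deriv g m' = 0 \<and> (\<forall>x\<in>{m'<..}. deriv g x < 0))"
    then obtain g where g: "is_density_of g (TS_one \<alpha> \<beta> l)" "smooth g" "deriv g m' = 0" by auto
    have "g = dens 0"
      using g TS_one_is_density by (intro continuous_density_unique smooth_continuous dens_cont) auto
    then have "dens 1 m' = 0" using g d1 by simp
    then show "m' = m" using m(2)[of m'] m(4)[of m'] m' by (cases m' m rule: linorder_cases) auto
  qed
  with m show "0 < mode (TS_one \<alpha> \<beta> l)" "\<And>x. 0 < x \<Longrightarrow> x < mode (TS_one \<alpha> \<beta> l) \<Longrightarrow> 0 < dens 1 x"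
    "dens 1 (mode (TS_one \<alpha> \<beta> l)) = 0" "\<And>x. mode (TS_one \<alpha> \<beta> l) < x \<Longrightarrow> dens 1 x < 0" by auto
qed

end

section \<open>Two-sided densities\<close>

text \<open>Abstracts the one-sided densities so that two of them can be used in either order. In
  \<open>tilted\<close> the bound m depends on c and shadows the mode.\<close>

locale tilt_unimodal_density =
  fixes d :: "nat \<Rightarrow> real \<Rightarrow> real" and m :: real
  assumes d_deriv: "(d n has_real_derivative d (Suc n) x) (at x)"
    and d_bounded: "\<exists>B. \<forall>x. \<bar>d n x\<bar> \<le> B"
    and d_zero: "x \<le> 0 \<Longrightarrow> d 0 x = 0" and d_pos: "0 < x \<Longrightarrow> 0 < d 0 x"
    and d_int: "integrable lborel (d 0)"
    and m_pos: "0 < m" and d1_pos: "0 < x \<Longrightarrow> x < m \<Longrightarrow> 0 < d 1 x"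
    and d1_mode: "d 1 m = 0" and d1_neg: "m < x \<Longrightarrow> d 1 x < 0"
    and tilted: "0 \<le> c \<Longrightarrow> \<exists>m>0. (\<forall>x. 0 < x \<and> x < m \<longrightarrow> c * d 0 x < d 1 x) \<and> d 1 m = c * d 0 m
      \<and> (\<forall>x>m. d 1 x < c * d 0 x)"
begin

lemma d_cont: "continuous_on S (d n)"
  by (rule continuous_on_subset[OF _ subset_UNIV])
    (auto intro!: continuous_at_imp_continuous_on DERIV_isCont[OF d_deriv])

lemma d_meas [measurable]: "d n \<in> borel_measurable borel"
  by (rule borel_measurable_continuous_onI[OF d_cont])

lemma d_nonneg: "0 \<le> d 0 x"
  using d_zero[of x] d_pos[of x] by (cases "x \<le> 0") auto

lemma d1_zero: "x \<le> 0 \<Longrightarrow> d 1 x = 0"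
proof -
  assume x: "x \<le> 0"
  have "(d 0 has_real_derivative d 1 x) (at x)" using d_deriv[of 0] by simp
  then have "((\<lambda>h. (d 0 (x + h) - d 0 x) / h) \<longlongrightarrow> d 1 x) (at_left 0)"
    by (simp add: DERIV_def filterlim_at_split)
  moreover have "((\<lambda>h. (d 0 (x + h) - d 0 x) / h) \<longlongrightarrow> 0) (at_left 0)"
    using x by (intro tendsto_eventually) (auto simp: eventually_at_filter d_zero)
  ultimately show "d 1 x = 0" by (rule tendsto_unique[OF trivial_limit_at_left_real])
qed

text \<open>A total variation argument: beyond the mode, - d 1 is nonnegative and its integral over
  [m, m + n] telescopes to d 0 m - d 0 (m + n), which converges. This permits a second
  differentiation of the convolution on the other factor.\<close>

lemma d1_int: "integrable lborel (d 1)"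
proof -
  have d1: "(d 0 has_real_derivative d 1 x) (at x)" for x using d_deriv[of 0] by simp
  have "integrable lborel (\<lambda>x. - d 1 x * indicator {m..} x)"
  proof -
    have seg: "integrable lborel (\<lambda>x. - d 1 x * indicator {m..m + real n} x)"
      and segI: "(LINT x|lborel. - d 1 x * indicator {m..m + real n} x) = d 0 m - d 0 (m + real n)" for n
    proof -
      have "continuous_on {m..m + real n} (\<lambda>x. - d 1 x)" by (intro continuous_intros d_cont)
      from borel_integrable_atLeastAtMost'[OF this]
      show "integrable lborel (\<lambda>x. - d 1 x * indicator {m..m + real n} x)"
        by (simp add: set_integrable_def mult.commute)
      have "(LINT x|lborel. indicator {m..m + real n} x *\<^sub>R (- d 1 x)) = (- d 0 (m + real n)) - (- d 0 m)"
        by (rule integral_FTC_atLeastAtMost)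
          (auto intro!: continuous_intros d_cont derivative_eq_intros has_field_derivative_at_within[OF d1]
            simp: has_real_derivative_iff_has_vector_derivative[symmetric])
      then show "(LINT x|lborel. - d 1 x * indicator {m..m + real n} x) = d 0 m - d 0 (m + real n)"
        by (simp add: mult.commute)
    qed
    have nn: "0 \<le> - d 1 x" if "m \<le> x" for x using d1_neg[of x] d1_mode that by (cases "x = m") auto
    have "decseq (\<lambda>n. d 0 (m + real n))"
    proof (rule decseq_SucI)
      fix n
      show "d 0 (m + real (Suc n)) \<le> d 0 (m + real n)"
      proof (rule DERIV_nonpos_imp_nonincreasing[where f="d 0"])
        show "\<exists>y. DERIV (d 0) x :> y \<and> y \<le> 0" if "m + real n \<le> x" for x
          using d1[of x] nn[of x] that by (intro exI[of _ "d 1 x"]) auto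
      qed simp
    qed
    then obtain L where "(\<lambda>n. d 0 (m + real n)) \<longlonglongrightarrow> L"
      using decseq_convergent[of "\<lambda>n. d 0 (m + real n)" 0] d_nonneg by blast
    then have "(\<lambda>n. LINT x|lborel. - d 1 x * indicator {m..m + real n} x) \<longlonglongrightarrow> d 0 m - L"
      unfolding segI by (intro tendsto_intros)
    note lim = this
    have mono: "AE x in lborel. mono (\<lambda>n. - d 1 x * indicator {m..m + real n} x)"
      using nn by (intro AE_I2) (auto simp: mono_def indicator_def)
    have pointwise: "AE x in lborel. (\<lambda>n. - d 1 x * indicator {m..m + real n} x) \<longlonglongrightarrow> - d 1 x * indicator {m..} x"
    proof (intro AE_I2 tendsto_eventually)
      fix x
      obtain N :: nat where N: "x - m < real N" using reals_Archimedean2 by blast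
      show "\<forall>\<^sub>F n in sequentially. - d 1 x * indicator {m..m + real n} x = - d 1 x * indicator {m..} x"
        using eventually_ge_at_top[of N] by eventually_elim (use N in \<open>auto simp: indicator_def\<close>)
    qed
    show ?thesis by (rule integrable_monotone_convergence[OF seg mono pointwise lim]) measurable
  qed
  moreover have "integrable lborel (\<lambda>x. d 1 x * indicator {0..m} x)"
    using borel_integrable_atLeastAtMost'[OF d_cont, of 0 m 1] by (simp add: set_integrable_def mult.commute)
  \<comment> \<open>The two pieces overlap in m, where d 1 vanishes.\<close>
  ultimately have "integrable lborel (\<lambda>x. d 1 x * indicator {0..m} x - (- d 1 x * indicator {m..} x))"
    by (intro Bochner_Integration.integrable_diff)
  also have "(\<lambda>x. d 1 x * indicator {0..m} x - (- d 1 x * indicator {m..} x)) = d 1"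
  proof
    fix x
    consider "x \<le> 0" | "0 < x" "x < m" | "x = m" | "m < x" by linarith
    then show "d 1 x * indicator {0..m} x - (- d 1 x * indicator {m..} x) = d 1 x"
      using m_pos by cases (auto simp: d1_zero[unfolded One_nat_def] d1_mode[unfolded One_nat_def])
  qed
  finally show ?thesis .
qed

end

lemma tempered_tilt_unimodal_density:
  assumes "tempered \<alpha> \<beta> l"
  shows "tilt_unimodal_density (tempered.dens \<alpha> \<beta> l) (mode (TS_one \<alpha> \<beta> l))"
proof -
  interpret tempered \<alpha> \<beta> l by fact
  show ?thesis
    by unfold_locales
      (use dens_deriv dens_bounded dens_zero dens_pos dens_integrable mode_TS_one dens_tilted_unimodal in auto)
qed

text \<open>With \<open>c = q'(a - t) / q(a - t)\<close>, the tilt of \<open>q\<close> by \<open>c\<close> has its mode exactly at \<open>a - t\<close>, so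
  both factors of \<open>p'(u) (q'(u - t) - c q(u - t))\<close> change sign at \<open>u = a\<close>.\<close>

lemma tilted_overlap:
  assumes "tilt_unimodal_density p a" "tilt_unimodal_density q b" and t: "t < a" "a - t \<le> b"
  shows "\<exists>c. 0 < (LINT u|lborel. p 1 u * q 1 (u - t)) - c * (LINT u|lborel. p 1 u * q 0 (u - t))"
proof -
  interpret p: tilt_unimodal_density p a by fact
  interpret q: tilt_unimodal_density q b by fact
  define c where "c = q 1 (a - t) / q 0 (a - t)"
  have q0: "0 < q 0 (a - t)" using q.d_pos t by simp
  \<comment> \<open>a - t \<le> b puts a - t on the rising side of q, so the required tilt has c
    \<ge> 0.\<close>
  have "0 \<le> q 1 (a - t)" using q.d1_pos[of "a - t"] q.d1_mode t by (cases "a - t = b") auto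
  then have c0: "0 \<le> c" using q0 by (simp add: c_def)
  have ceq: "q 1 (a - t) = c * q 0 (a - t)" using q0 by (simp add: c_def)
  obtain m where m: "0 < m" "\<And>x. 0 < x \<Longrightarrow> x < m \<Longrightarrow> c * q 0 x < q 1 x" "\<And>x. m < x \<Longrightarrow> q 1 x < c * q 0 x"
    using q.tilted[OF c0] by auto
  have mt: "m = a - t"
    using m(2)[of "a - t"] m(3)[of "a - t"] ceq t by (cases m "a - t" rule: linorder_cases) auto
  have int: "integrable lborel (\<lambda>u. p 1 u * q n (u - t))" for n
  proof -
    obtain B where B: "\<And>x. \<bar>q n x\<bar> \<le> B" using q.d_bounded by blast
    have "continuous_on UNIV (\<lambda>x. q n (- x))"
      by (intro continuous_on_compose2[OF q.d_cont] continuous_intros) auto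
    from continuous_on_lebesgue_integral_shift[OF this B p.d1_int, of t]
    show ?thesis by (simp add: mult.commute)
  qed
  let ?h = "\<lambda>u. p 1 u * q 1 (u - t) - c * (p 1 u * q 0 (u - t))"
  have "0 < integral\<^sup>L lborel ?h"
  proof (rule lborel_integral_pos)
    have h: "?h u = p 1 u * (q 1 (u - t) - c * q 0 (u - t))" for u by (simp add: algebra_simps)
    \<comment> \<open>Strictness comes from the right of a, where both factors are negative; the
      length 1 is arbitrary.\<close>
    show pos: "0 < ?h u" if "a < u" "u < a + 1" for u
      unfolding h using p.d1_neg[of u] m(3)[of "u - t"] mt that by (intro mult_neg_neg) auto
    show "0 \<le> ?h u" for u
    proof -
      consider "u \<le> 0" | "u - t \<le> 0" | "0 < u" "u < a" "0 < u - t" | "u = a" | "a < u" by linarith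
      then show ?thesis
      proof cases
        case 3
        then show ?thesis
          unfolding h using p.d1_pos[of u] m(2)[of "u - t"] mt by (intro mult_nonneg_nonneg) auto
      next
        case 5
        then show ?thesis
          unfolding h using p.d1_neg[of u] m(3)[of "u - t"] mt by (intro mult_nonpos_nonpos) auto
      qed (use p.d1_zero p.d1_mode q.d_zero q.d1_zero in \<open>auto simp: h\<close>)
    qed
    show "integrable lborel ?h" using int by auto
  qed auto
  then show ?thesis using int by (intro exI[of _ c]) simp
qed

locale two_sided = p: tilt_unimodal_density p a + q: tilt_unimodal_density q b for p a q b
begin

text \<open>All n derivatives fall on p. Substituting u = x - y, as in \<open>g_eq\<close>, moves x
  into the factor q, where it can be differentiated instead.\<close>

definition g :: "nat \<Rightarrow> real \<Rightarrow> real"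
  where "g n x = (LINT y|lborel. p n (x - y) * q 0 (- y))"

lemma q_reflect_int: "integrable lborel (\<lambda>y. q 0 (- y))"
  using lborel_integrable_real_affine[OF q.d_int, of "-1" 0] by simp

lemma g_deriv: "(g n has_real_derivative g (Suc n) x) (at x)"
proof -
  obtain B B' where "\<And>x. \<bar>p n x\<bar> \<le> B" "\<And>x. \<bar>p (Suc n) x\<bar> \<le> B'" using p.d_bounded by meson
  then show ?thesis unfolding g_def[abs_def]
    by (intro has_real_derivative_convolution[OF p.d_deriv p.d_cont _ _ q_reflect_int])
qed

lemma g_cont: "continuous_on S (g n)"
  by (rule continuous_on_subset[OF _ subset_UNIV])
    (auto intro!: continuous_at_imp_continuous_on DERIV_isCont[OF g_deriv])

lemma integral_shift: "(LINT y|lborel. f (x - y) (- y)) = (LINT u|lborel. f u (u - x))"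
  for f :: "real \<Rightarrow> real \<Rightarrow> real"
  using lborel_integral_real_affine[of "-1" "\<lambda>y. f (x - y) (- y)" x] by simp

lemma g_eq: "g n x = (LINT u|lborel. p n u * q 0 (u - x))"
  unfolding g_def by (rule integral_shift)

lemma q_side_deriv:
  assumes "integrable lborel f"
  shows "((\<lambda>x. LINT u|lborel. f u * q 0 (u - x)) has_real_derivative - (LINT u|lborel. f u * q 1 (u - x))) (at x)"
proof -
  obtain B B' where B: "\<And>x. \<bar>q 0 x\<bar> \<le> B" "\<And>x. \<bar>q 1 x\<bar> \<le> B'" using q.d_bounded by meson
  have "((\<lambda>x. LINT u|lborel. q 0 (- (x - u)) * f u) has_real_derivative (LINT u|lborel. - q 1 (- (x - u)) * f u)) (at x)"
  proof (rule has_real_derivative_convolution[OF _ _ _ _ assms])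
    show "((\<lambda>x. q 0 (- x)) has_real_derivative - q 1 (- x)) (at x)" for x
    proof -
      have "(uminus has_real_derivative - 1) (at x)" by (auto intro!: derivative_eq_intros)
      from DERIV_chain2[OF q.d_deriv this, of 0] show ?thesis by simp
    qed
    show "continuous_on UNIV (\<lambda>x. - q 1 (- x))"
      by (intro continuous_intros continuous_on_compose2[OF q.d_cont]) auto
  qed (use B in auto)
  then show ?thesis by (simp add: mult.commute)
qed

lemma g1_eq: "g 1 x = - (LINT u|lborel. p 0 u * q 1 (u - x))"
proof -
  have "g 0 = (\<lambda>x. LINT u|lborel. p 0 u * q 0 (u - x))" by (rule ext) (rule g_eq)
  with q_side_deriv[OF p.d_int, of x]
  have "(g 0 has_real_derivative - (LINT u|lborel. p 0 u * q 1 (u - x))) (at x)" by simp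
  moreover have "(g 0 has_real_derivative g 1 x) (at x)" using g_deriv[of 0] by simp
  ultimately show ?thesis by (rule DERIV_unique[symmetric])
qed

lemma g2_eq: "g 2 x = - (LINT u|lborel. p 1 u * q 1 (u - x))"
proof -
  have "g 1 = (\<lambda>x. LINT u|lborel. p 1 u * q 0 (u - x))" by (rule ext) (rule g_eq)
  with q_side_deriv[OF p.d1_int, of x]
  have "(g 1 has_real_derivative - (LINT u|lborel. p 1 u * q 1 (u - x))) (at x)" by simp
  moreover have "(g 1 has_real_derivative g 2 x) (at x)" using g_deriv[of 1] by (simp add: numeral_2_eq_2)
  ultimately show ?thesis by (rule DERIV_unique[symmetric])
qed

text \<open>With the derivative on p, only points x - y > a beyond the mode of p meet a nonzero
  value of q.\<close>

lemma g1_neg: "a \<le> x \<Longrightarrow> g 1 x < 0"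
proof -
  assume x: "a \<le> x"
  obtain B where B: "\<And>x. \<bar>p 1 x\<bar> \<le> B" using p.d_bounded by blast
  have int: "integrable lborel (\<lambda>y. p 1 (x - y) * q 0 (- y))"
    by (rule continuous_on_lebesgue_integral_shift[OF p.d_cont B q_reflect_int])
  have "0 < (LINT y|lborel. - (p 1 (x - y) * q 0 (- y)))"
  proof (rule lborel_integral_pos[where a="-1" and b=0])
    show "0 < - (p 1 (x - y) * q 0 (- y))" if "y < 0" for y
      using p.d1_neg[of "x - y"] q.d_pos[of "- y"] that x by (simp add: mult_neg_pos)
    then show "0 \<le> - (p 1 (x - y) * q 0 (- y))" for y
      using q.d_zero[of "- y"] by (cases "y < 0") (auto intro: less_imp_le)
  qed (use int in auto)
  then show "g 1 x < 0" by (simp add: g_def)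
qed

text \<open>With the derivative on q, only points u - x > b beyond the mode of q meet a nonzero
  value of p.\<close>

lemma g1_pos: "x \<le> - b \<Longrightarrow> 0 < g 1 x"
proof -
  assume x: "x \<le> - b"
  obtain B where B: "\<And>x. \<bar>q 1 x\<bar> \<le> B" using q.d_bounded by blast
  have "continuous_on UNIV (\<lambda>x. q 1 (- x))"
    by (intro continuous_on_compose2[OF q.d_cont] continuous_intros) auto
  from continuous_on_lebesgue_integral_shift[OF this B p.d_int, of x]
  have int: "integrable lborel (\<lambda>u. p 0 u * q 1 (u - x))" by (simp add: mult.commute)
  have "0 < (LINT u|lborel. - (p 0 u * q 1 (u - x)))"
  proof (rule lborel_integral_pos[where a=0 and b=1])
    show "0 < - (p 0 u * q 1 (u - x))" if "0 < u" for u
      using p.d_pos[OF that] q.d1_neg[of "u - x"] that x by (simp add: mult_pos_neg)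
    then show "0 \<le> - (p 0 u * q 1 (u - x))" for u
      using p.d_zero[of u] by (cases "0 < u") (auto intro: less_imp_le)
  qed (use int in auto)
  then show "0 < g 1 x" unfolding g1_eq by simp
qed

text \<open>The tilt goes to the density whose mode lies further right, after q has been shifted to
  have its mode at b + x. The term with c drops out in both cases, since g 1 x = 0 can be read with
  the derivative on p or on q.\<close>

lemma g2_neg_at_critical:
  assumes x: "- b < x" "x < a" and crit: "g 1 x = 0"
  shows "g 2 x < 0"
proof (cases "a - x \<le> b")
  case True
  obtain c where "0 < (LINT u|lborel. p 1 u * q 1 (u - x)) - c * (LINT u|lborel. p 1 u * q 0 (u - x))"
    using tilted_overlap[OF p.tilt_unimodal_density_axioms q.tilt_unimodal_density_axioms x(2) True] by blast
  then show ?thesis using crit unfolding g_eq[of 1] g2_eq by simp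
next
  case False
  obtain c where c: "0 < (LINT u|lborel. q 1 u * p 1 (u - - x)) - c * (LINT u|lborel. q 1 u * p 0 (u - - x))"
    using tilted_overlap[OF q.tilt_unimodal_density_axioms p.tilt_unimodal_density_axioms, of "- x"] x False by auto
  have sh: "(LINT u|lborel. q 1 u * p n (u - - x)) = (LINT u|lborel. p n u * q 1 (u - x))" for n
    using lborel_integral_real_affine[of 1 "\<lambda>u. p n u * q 1 (u - x)" x] by (simp add: mult.commute add.commute)
  show ?thesis using c crit unfolding sh g1_eq g2_eq by simp
qed

text \<open>g 1 can only cross zero downwards. After its first zero s it is negative for a while,
  and a return to zero would be a crossing upwards.\<close>

theorem sign_change:
  "\<exists>x0. - b < x0 \<and> x0 < a \<and> (\<forall>x<x0. 0 < g 1 x) \<and> g 1 x0 = 0 \<and> (\<forall>x>x0. g 1 x < 0)"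
proof -
  have g1_deriv: "(g 1 has_real_derivative g 2 x) (at x)" for x
    using g_deriv[of 1 x] by (simp add: numeral_2_eq_2)
  have left_zero: "h s = 0"
    if h: "continuous_on UNIV h" "r < s" "h s \<le> 0" "\<And>x. r \<le> x \<Longrightarrow> x < s \<Longrightarrow> 0 < h x" for h :: "real \<Rightarrow> real" and r s
  proof -
    have "(h \<longlongrightarrow> h s) (at_left s)"
      using h(1) by (simp add: continuous_on_eq_continuous_at isCont_def filterlim_at_split)
    moreover have "\<forall>\<^sub>F x in at_left s. 0 \<le> h x"
      using eventually_at_left_real[OF h(2)] by (auto elim!: eventually_mono intro!: less_imp_le h(4))
    ultimately have "0 \<le> h s" by (intro tendsto_lowerbound) auto
    with h(3) show ?thesis by simp
  qed
  have "- b \<le> a" using p.m_pos q.m_pos by simp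
  moreover have "g 1 a \<le> 0" using g1_neg[of a] by simp
  ultimately obtain s where s: "- b \<le> s" "s \<le> a" "g 1 s \<le> 0" "\<And>x. - b \<le> x \<Longrightarrow> x < s \<Longrightarrow> 0 < g 1 x"
    using first_nonpos[OF g_cont] by metis
  have sb: "- b < s" using g1_pos[of "- b"] s(1,3) by (cases "s = - b") auto
  have gs: "g 1 s = 0" by (rule left_zero[OF g_cont sb s(3,4)])
  have sa: "s < a" using g1_neg[of a] gs s(2) by (cases "s = a") auto
  have left: "0 < g 1 x" if "x < s" for x
    using g1_pos[of x] s(4)[of x] that by (cases "x \<le> - b") auto
  have right: "g 1 x < 0" if x: "s < x" for x
  proof (rule ccontr)
    assume gx: "\<not> g 1 x < 0"
    then have xa: "x < a" using g1_neg[of x] by force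
    obtain e where e: "e > 0" "\<And>h. 0 < h \<Longrightarrow> h < e \<Longrightarrow> g 1 (s + h) < g 1 s"
      using DERIV_neg_dec_right[OF g1_deriv g2_neg_at_critical[OF sb sa gs]] by blast
    \<comment> \<open>A point past s, but not past x, where g 1 is already negative; searching from
      r on avoids finding s again.\<close>
    define r where "r = s + min (e / 2) (x - s)"
    have r: "s < r" "r \<le> x" using e(1) x by (auto simp: r_def)
    have "g 1 r < 0" using e(2)[of "min (e / 2) (x - s)"] e(1) x gs by (simp add: r_def)
    moreover have "continuous_on UNIV (\<lambda>x. - g 1 x)" by (intro continuous_intros g_cont)
    moreover have "- g 1 x \<le> 0" using gx by simp
    ultimately obtain v where v: "r \<le> v" "v \<le> x" "- g 1 v \<le> 0" "\<And>x. r \<le> x \<Longrightarrow> x < v \<Longrightarrow> 0 < - g 1 x"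
      using first_nonpos[of "\<lambda>x. - g 1 x" r x] r(2) by metis
    have rv: "r < v" using v(1,3) \<open>g 1 r < 0\<close> by (cases "r = v") auto
    have gv: "g 1 v = 0"
      using left_zero[OF \<open>continuous_on UNIV (\<lambda>x. - g 1 x)\<close> rv v(3,4)] by simp
    \<comment> \<open>At the return point v the negative slope makes g 1 positive just before v,
      against its negativity on [r, v).\<close>
    obtain e' where e': "e' > 0" "\<And>h. 0 < h \<Longrightarrow> h < e' \<Longrightarrow> g 1 v < g 1 (v - h)"
      using DERIV_neg_dec_left[OF g1_deriv g2_neg_at_critical[of v]] sb r v xa gv by force
    have "0 < g 1 (v - min (e' / 2) (v - r))"
      using e'(2)[of "min (e' / 2) (v - r)"] e'(1) rv gv by simp
    moreover have "0 < - g 1 (v - min (e' / 2) (v - r))"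
      using e'(1) rv by (intro v(4)) auto
    ultimately show False by simp
  qed
  show ?thesis using sb sa gs left right by blast
qed

end

section \<open>Densities of duals and convolutions, and the conclusion\<close>

lemma finite_measure_density:
  assumes "integrable lborel f" "\<And>x. 0 \<le> f x"
  shows "finite_measure (density lborel (\<lambda>x. ennreal (f x)))"
proof
  have [measurable]: "f \<in> borel_measurable lborel" using assms by auto
  show "emeasure (density lborel (\<lambda>x. ennreal (f x))) (space (density lborel (\<lambda>x. ennreal (f x)))) \<noteq> \<infinity>"
    using nn_integral_eq_integral[OF assms(1)] assms(2) by (simp add: emeasure_density)
qed

lemma dual_density:
  assumes [measurable]: "f \<in> borel_measurable borel"
  shows "dual (density lborel (\<lambda>x. ennreal (f x))) = density lborel (\<lambda>x. ennreal (f (- x)))"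
proof (rule measure_eqI)
  fix A assume "A \<in> sets (dual (density lborel (\<lambda>x. ennreal (f x))))"
  then have A [measurable]: "A \<in> sets borel" by (simp add: dual_def)
  have "emeasure (dual (density lborel (\<lambda>x. ennreal (f x)))) A = (\<integral>\<^sup>+x. ennreal (f x) * indicator A (- x) \<partial>lborel)"
  proof -
    have B: "uminus -` A \<in> sets borel" by (rule measurable_sets_borel[OF _ A]) simp
    have "emeasure (dual (density lborel (\<lambda>x. ennreal (f x)))) A
        = emeasure (density lborel (\<lambda>x. ennreal (f x))) (uminus -` A)"
      unfolding dual_def by (subst emeasure_distr) (simp_all add: A)
    also have "\<dots> = (\<integral>\<^sup>+x. ennreal (f x) * indicator (uminus -` A) x \<partial>lborel)"
      using B by (intro emeasure_density) auto
    also have "\<dots> = (\<integral>\<^sup>+x. ennreal (f x) * indicator A (- x) \<partial>lborel)"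
      by (simp add: indicator_def)
    finally show ?thesis .
  qed
  also have "\<dots> = (\<integral>\<^sup>+x. ennreal (f (- x)) * indicator A x \<partial>lborel)"
    using nn_integral_real_affine[of "\<lambda>x. ennreal (f x) * indicator A (- x)" "-1" 0] by simp
  finally show "emeasure (dual (density lborel (\<lambda>x. ennreal (f x)))) A
      = emeasure (density lborel (\<lambda>x. ennreal (f (- x)))) A"
    by (simp add: emeasure_density)
qed (simp add: dual_def)

lemma (in two_sided) convolution_dual_density:
  "is_density_of (g 0) (density lborel (p 0) \<star> dual (density lborel (q 0)))"
proof -
  have nn: "0 \<le> g 0 x" for x
    unfolding g_def by (intro Bochner_Integration.integral_nonneg mult_nonneg_nonneg p.d_nonneg q.d_nonneg)
  have "density lborel (p 0) \<star> dual (density lborel (q 0))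
      = density lborel (\<lambda>x. \<integral>\<^sup>+y. ennreal (p 0 (x - y)) * ennreal (q 0 (- y)) \<partial>lborel)"
    by (subst dual_density, simp, rule convolution_density)
      (auto intro!: finite_measure_density p.d_int q_reflect_int p.d_nonneg q.d_nonneg)
  also have "(\<lambda>x. \<integral>\<^sup>+y. ennreal (p 0 (x - y)) * ennreal (q 0 (- y)) \<partial>lborel) = (\<lambda>x. ennreal (g 0 x))"
  proof
    fix x
    obtain B where B: "\<And>x. \<bar>p 0 x\<bar> \<le> B" using p.d_bounded by blast
    have "integrable lborel (\<lambda>y. p 0 (x - y) * q 0 (- y))"
      by (rule continuous_on_lebesgue_integral_shift[OF p.d_cont B q_reflect_int])
    then show "(\<integral>\<^sup>+y. ennreal (p 0 (x - y)) * ennreal (q 0 (- y)) \<partial>lborel) = ennreal (g 0 x)"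
      unfolding g_def using p.d_nonneg q.d_nonneg
      by (simp add: ennreal_mult[symmetric] nn_integral_eq_integral)
  qed
  finally show ?thesis
    using nn borel_measurable_continuous_onI[OF g_cont] by (simp add: is_density_of_def)
qed

theorem theorem7p8:
  fixes \<alpha>p \<beta>p lp \<alpha>m \<beta>m lm :: real
  assumes "\<alpha>p > 0" and "lp > 0" and "\<alpha>m > 0" and "lm > 0"
    and "\<beta>p \<in> {0<..<1}" and "\<beta>m \<in> {0<..<1}"
  shows "\<exists>g. is_density_of g (TS \<alpha>p \<beta>p lp \<alpha>m \<beta>m lm) \<and> smooth g \<and>
           (\<exists>x\<^sub>0. (\<forall>x\<in>{..<x\<^sub>0}. deriv g x > 0) \<and>
                 deriv g x\<^sub>0 = 0 \<and>
                 (\<forall>x\<in>{x\<^sub>0<..}. deriv g x < 0) \<and>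
                 x\<^sub>0 \<in> {- mode (TS_one \<alpha>m \<beta>m lm) <..< mode (TS_one \<alpha>p \<beta>p lp)})"
proof -
  have tp: "tempered \<alpha>p \<beta>p lp" and tm: "tempered \<alpha>m \<beta>m lm"
    using assms by (auto simp: tempered_def)
  interpret two_sided "tempered.dens \<alpha>p \<beta>p lp" "mode (TS_one \<alpha>p \<beta>p lp)"
      "tempered.dens \<alpha>m \<beta>m lm" "mode (TS_one \<alpha>m \<beta>m lm)"
    by (intro two_sided.intro tempered_tilt_unimodal_density tp tm)
  have "is_density_of (g 0) (TS \<alpha>p \<beta>p lp \<alpha>m \<beta>m lm)"
    using convolution_dual_density unfolding TS_def tempered.TS_one_eq[OF tp] tempered.TS_one_eq[OF tm] .
  moreover have "smooth (g 0)" "deriv (g 0) = g 1"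
    using smooth_of_derivatives[where d=g, OF g_deriv] smooth_of_derivatives(2)[where d=g, OF g_deriv, of 1] by simp_all
  ultimately show ?thesis
    using sign_change by (intro exI[of _ "g 0"]) auto
qed

end
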